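(* Let $\nu>3$ and let $m=m(n)$ be polynomially bounded in $n$ with $m\in\Omega(n^{\nu})$. Let $U\in U(m)$ be drawn from the Haar measure $\mu_H$. Then, with probability supra-exponentially close to one in $n$, no symmetric probabilistic algorithm can distinguish the Boson-Sampling distribution $\mathcal{D}_U$ from the uniform distribution on $\Phi_{m,n}$ from fewer than $\Omega(\mathrm{e}^{n/2})$ many samples. Explicitly: there exist a constant $a>0$ and a function $\delta:\mathbb{Z}^+\to[0,1]$ with $\lim_{n\to\infty}\delta(n)\,\mathrm{e}^{Cn}=0$ for every $C>0$ such that for all $n$ the following holds with probability at least $1-\delta(n)$ over $U\sim\mu_H$: for every $l\le a\,\mathrm{e}^{n/2}$, no symmetric probabilistic algorithm receiving $l$ samples distinguishes $\mathcal{D}_U$ from the uniform distribution on $\Phi_{m,n}$.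
   Context: Boson-Sampling. Let $n\ge1$ (number of bosons) and $m\ge n$ (number of modes); throughout $m\in\mathrm{poly}(n)$. The sample space is $\Phi_{m,n}=\{(s_1,\dots,s_m)\in\mathbb{Z}_{\ge0}^m:\sum_{j=1}^m s_j=n\}$. For $U\in U(m)$ and $S=(s_1,\dots,s_m)\in\Phi_{m,n}$, $U_S\in\mathbb{C}^{n\times n}$ is the matrix obtained from $U$ by keeping only the first $n$ columns and then taking, for each $j=1,\dots,m$, $s_j$ copies of the $j$-th row. The permanent of an $n\times n$ matrix $X$ is $\operatorname{Perm}(X)=\sum_{\tau\in\mathrm{Sym}(\{1,\dots,n\})}\prod_{j=1}^n x_{j,\tau(j)}$. The Boson-Sampling distribution $\mathcal{D}_U$ on $\Phi_{m,n}$ is $\Pr_{\mathcal{D}_U}[S]=|\operatorname{Perm}(U_S)|^2/\prod_{j=1}^m s_j!$. Symmetric probabilistic algorithm (one black box). For a finite sample space $\Phi$ and $l\in\mathbb{Z}^+$, a probabilistic decision algorithm takes as input a sequence $(S_1,\dots,S_l)\in\Phi^l$ and outputs at random either "accept" or "reject". It is symmetric if its output distribution is invariant under permuting the samples, $(S_1,\dots,S_l)\mapsto(S_{\tau(1)},\dots,S_{\tau(l)})$ with $\tau\in\mathrm{Sym}(\{1,\dots,l\})$, and under relabeling the sample space, $(S_1,\dots,S_l)\mapsto(\kappa(S_1),\dots,\kappa(S_l))$ with $\kappa\in\mathrm{Sym}(\Phi)$. Distinguishing. An algorithm receiving $l$ samples distinguishes $\mathcal{P}$ from $\mathcal{Q}$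 (both on $\Phi$) if it accepts with probability at least $2/3$ when its input consists of $l$ independent samples from $\mathcal{P}$ and rejects with probability at least $2/3$ when its input consists of $l$ independent samples from $\mathcal{Q}$. *)

theory Defs
  imports
    "HOL-Probability.Probability"
    "HOL-Library.Landau_Symbols"
    "HOL-Combinatorics.Combinatorics"
    "Jordan_Normal_Form.Schur_Decomposition"
begin


definition permanent :: "'a :: comm_semiring_1 mat \<Rightarrow> 'a" where
  "permanent X = (\<Sum>\<tau> | \<tau> permutes {..<dim_row X}. \<Prod>j<dim_row X. X $$ (j, \<tau> j))"

(* Occupation numbers (s_1, ..., s_m) are lists of length m; the mode indices are 0, ..., m - 1. *)
definition boson_samples :: "nat \<Rightarrow> nat \<Rightarrow> nat list set" where
  "boson_samples m n = {S. length S = m \<and> sum_list S = n}"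

definition row_indices :: "nat list \<Rightarrow> nat list" where
  "row_indices S = concat (map (\<lambda>j. replicate (S ! j) j) [0..<length S])"

(* The matrix U_S for S in boson_samples m n: columns 0, ..., n - 1 of U, with S ! j copies of row j. *)
definition boson_submatrix :: "nat \<Rightarrow> complex mat \<Rightarrow> nat list \<Rightarrow> complex mat" where
  "boson_submatrix n U S = Matrix.mat n n (\<lambda>(i, k). U $$ (row_indices S ! i, k))"

definition boson_prob :: "nat \<Rightarrow> nat \<Rightarrow> complex mat \<Rightarrow> nat list \<Rightarrow> real" where
  "boson_prob m n U S =
     (if S \<in> boson_samples m n
      then (cmod (permanent (boson_submatrix n U S)))\<^sup>2 / (\<Prod>j<m. fact (S ! j)) else 0)"

(* Meaningful for unitary U and n <= m, see pmf_boson_sampling below. *)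
definition boson_sampling :: "nat \<Rightarrow> nat \<Rightarrow> complex mat \<Rightarrow> nat list pmf" where
  "boson_sampling m n U = embed_pmf (boson_prob m n U)"

definition unitary_group :: "nat \<Rightarrow> complex mat set" where
  "unitary_group m = {U \<in> carrier_mat m m. mat_adjoint U * U = 1\<^sub>m m}"

(* The Borel sets of U(m) in the topology of entrywise convergence. *)
definition unitary_borel :: "nat \<Rightarrow> complex mat measure" where
  "unitary_borel m =
     vimage_algebra (unitary_group m) (\<lambda>U. \<lambda>p\<in>{..<m} \<times> {..<m}. U $$ p)
       (Pi\<^sub>M ({..<m} \<times> {..<m}) (\<lambda>_. borel))"

(* U(m) is compact, so the left-invariant probability measure is unique and also right-invariant. *)
definition haar_measure :: "nat \<Rightarrow> complex mat measure \<Rightarrow> bool" where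
  "haar_measure m \<mu> \<longleftrightarrow>
     prob_space \<mu> \<and> sets \<mu> = sets (unitary_borel m) \<and>
     (\<forall>V\<in>unitary_group m. distr \<mu> \<mu> (\<lambda>U. V * U) = \<mu>)"

(* A probabilistic decision algorithm is a map from sample sequences to output distributions on
   bool, where True means accept; only its values on sequences in \<Phi>^l matter. *)
definition symmetric_algorithm :: "'a set \<Rightarrow> nat \<Rightarrow> ('a list \<Rightarrow> bool pmf) \<Rightarrow> bool" where
  "symmetric_algorithm \<Phi> l A \<longleftrightarrow>
     (\<forall>xs\<in>lists \<Phi>. length xs = l \<longrightarrow>
        (\<forall>\<tau>. \<tau> permutes {..<l} \<longrightarrow> A (permute_list \<tau> xs) = A xs) \<and>
        (\<forall>\<kappa>. \<kappa> permutes \<Phi> \<longrightarrow> A (map \<kappa> xs) = A xs))"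

definition distinguishes :: "nat \<Rightarrow> ('a list \<Rightarrow> bool pmf) \<Rightarrow> 'a pmf \<Rightarrow> 'a pmf \<Rightarrow> bool" where
  "distinguishes l A P Q \<longleftrightarrow>
     pmf (bind_pmf (replicate_pmf l P) A) True \<ge> 2 / 3 \<and>
     pmf (bind_pmf (replicate_pmf l Q) A) False \<ge> 2 / 3"

lemma finite_boson_samples: "finite (boson_samples m n)"
proof -
  have "boson_samples m n \<subseteq> {S. set S \<subseteq> {..n} \<and> length S = m}"
    by (auto simp: boson_samples_def dest: member_le_sum_list)
  then show ?thesis
    by (rule finite_subset) (rule finite_lists_length_eq, simp)
qed

lemma boson_samples_nonempty: "m \<ge> 1 \<Longrightarrow> boson_samples m n \<noteq> {}"
proof -
  assume "m \<ge> 1"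
  then have "n # replicate (m - 1) 0 \<in> boson_samples m n"
    by (simp add: boson_samples_def sum_list_replicate)
  then show ?thesis by blast
qed

lemma length_row_indices: "length (row_indices S) = sum_list S"
  by (simp add: row_indices_def length_concat comp_def map_nth)

lemma count_mset_row_indices:
  assumes "length S = m"
  shows "count (mset (row_indices S)) x = (if x < m then S ! x else 0)"
proof -
  have *: "count (mset (concat xss)) x = (\<Sum>xs\<leftarrow>xss. count (mset xs) x)" for xss
    by (induction xss) auto
  have "count (mset (row_indices S)) x = (\<Sum>j\<leftarrow>[0..<m]. if j = x then S ! j else 0)"
    unfolding row_indices_def assms * map_map
    by (intro arg_cong[of _ _ sum_list] map_cong refl) auto
  also have "\<dots> = (\<Sum>j\<in>{0..<m}. if j = x then S ! j else 0)"
    by (subst interv_sum_list_conv_sum_set_nat) simp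
  also have "\<dots> = (if x < m then S ! x else 0)"
    by (subst sum.delta) auto
  finally show ?thesis .
qed

lemma unitary_column_sum:
  assumes "U \<in> unitary_group m" "p < m" "q < m"
  shows "(\<Sum>x<m. U $$ (x, p) * cnj (U $$ (x, q))) = (if p = q then 1 else 0)"
proof -
  have U: "U \<in> carrier_mat m m" and eq: "mat_adjoint U * U = 1\<^sub>m m"
    using assms by (auto simp: unitary_group_def)
  have "(mat_adjoint U * U) $$ (q, p) = (\<Sum>x<m. cnj (U $$ (x, q)) * U $$ (x, p))"
    using U assms(2,3)
    by (simp add: mat_adjoint_def scalar_prod_def atLeast0LessThan)
  with eq assms(2,3) show ?thesis by (auto simp: mult.commute split: if_splits)
qed

lemma permanent_mat:
  "permanent (Matrix.mat n n h) = (\<Sum>\<tau> | \<tau> permutes {..<n}. \<Prod>j<n. h (j, \<tau> j))"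
  unfolding permanent_def dim_row_mat
proof (intro sum.cong prod.cong refl)
  fix \<tau> j assume "\<tau> \<in> {\<tau>. \<tau> permutes {..<n}}" "j \<in> {..<n}"
  then have "\<tau> j \<in> {..<n}" using permutes_in_image[of \<tau> "{..<n}" j] by blast
  with \<open>j \<in> {..<n}\<close> show "Matrix.mat n n h $$ (j, \<tau> j) = h (j, \<tau> j)" by simp
qed

lemma row_perm_invariant:
  assumes "mset f = mset g" "length f = n"
  shows "permanent (Matrix.mat n n (\<lambda>(i, k). U $$ (f ! i, k))) =
         permanent (Matrix.mat n n (\<lambda>(i, k). U $$ (g ! i, k)))"
proof -
  obtain \<sigma> where \<sigma>: "\<sigma> permutes {..<n}" and f: "permute_list \<sigma> g = f"
    using mset_eq_permutation[OF assms(1)] assms mset_eq_length by metis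
  have len: "length g = n" using assms mset_eq_length by metis
  have "permanent (Matrix.mat n n (\<lambda>(i, k). U $$ (f ! i, k))) =
     (\<Sum>\<tau> | \<tau> permutes {..<n}. \<Prod>j<n. U $$ (f ! j, \<tau> j))"
    by (simp add: permanent_mat)
  also have "\<dots> = (\<Sum>\<tau> | \<tau> permutes {..<n}. \<Prod>j<n. U $$ (g ! \<sigma> j, \<tau> j))"
    using \<sigma> len by (intro sum.cong prod.cong refl) (simp add: f[symmetric] permute_list_nth)
  also have "\<dots> = (\<Sum>\<tau> | \<tau> permutes {..<n}. \<Prod>j<n. U $$ (g ! \<sigma> j, (\<tau> \<circ> \<sigma>) j))"
    by (rule sum_permutations_compose_right[OF \<sigma>])
  also have "\<dots> = (\<Sum>\<tau> | \<tau> permutes {..<n}. \<Prod>j<n. U $$ (g ! j, \<tau> j))"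
    by (intro sum.cong refl, simp only: comp_def)
       (rule prod.permute[OF \<sigma>, symmetric, unfolded comp_def])
  also have "\<dots> = permanent (Matrix.mat n n (\<lambda>(i, k). U $$ (g ! i, k)))"
    by (simp add: permanent_mat)
  finally show ?thesis .
qed

lemma sum_lists_prod:
  fixes h :: "nat \<Rightarrow> 'a \<Rightarrow> 'b :: comm_semiring_1"
  assumes "finite A"
  shows "(\<Sum>f | set f \<subseteq> A \<and> length f = n. \<Prod>j<n. h j (f ! j)) = (\<Prod>j<n. \<Sum>x\<in>A. h j x)"
proof (induction n arbitrary: h)
  case 0
  have "{f. set f \<subseteq> A \<and> length f = 0} = {[]}" by auto
  then show ?case by simp
next
  case (Suc n)
  let ?L = "{f. set f \<subseteq> A \<and> length f = n}"
  have "(\<Sum>f | set f \<subseteq> A \<and> length f = Suc n. \<Prod>j<Suc n. h j (f ! j)) =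
        (\<Sum>(f, x)\<in>?L \<times> A. \<Prod>j<Suc n. h j ((x # f) ! j))"
    unfolding lists_length_Suc_eq
    by (subst sum.reindex) (auto simp: inj_on_def case_prod_beta)
  also have "\<dots> = (\<Sum>(f, x)\<in>?L \<times> A. h 0 x * (\<Prod>j<n. h (Suc j) (f ! j)))"
    by (simp only: prod.lessThan_Suc_shift nth_Cons_0 nth_Cons_Suc)
  also have "\<dots> = (\<Sum>f\<in>?L. \<Sum>x\<in>A. h 0 x * (\<Prod>j<n. h (Suc j) (f ! j)))"
    by (rule sum.cartesian_product[symmetric])
  also have "\<dots> = (\<Sum>x\<in>A. h 0 x) * (\<Sum>f\<in>?L. \<Prod>j<n. h (Suc j) (f ! j))"
    by (simp add: sum_distrib_right[symmetric] sum_distrib_left[symmetric])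
  also have "\<dots> = (\<Prod>j<Suc n. \<Sum>x\<in>A. h j x)"
    using Suc.IH[of "\<lambda>j. h (Suc j)"] by (simp only: prod.lessThan_Suc_shift)
  finally show ?case .
qed

lemma sum_permanents_lists:
  assumes U: "U \<in> unitary_group m" and "n \<le> m"
  shows "(\<Sum>f | set f \<subseteq> {..<m} \<and> length f = n.
            (cmod (permanent (Matrix.mat n n (\<lambda>(i, k). U $$ (f ! i, k)))))\<^sup>2) = fact n"
proof -
  let ?L = "{f. set f \<subseteq> {..<m} \<and> length f = n}" and ?P = "{\<tau>. \<tau> permutes {..<n}}"
  let ?perm = "\<lambda>f. permanent (Matrix.mat n n (\<lambda>(i, k). U $$ (f ! i, k)))"
  have fin: "finite ?P" by (simp add: finite_permutations)
  have perm: "?perm f = (\<Sum>\<tau>\<in>?P. \<Prod>j<n. U $$ (f ! j, \<tau> j))" for f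
    by (simp add: permanent_mat)
  have "complex_of_real (\<Sum>f\<in>?L. (cmod (?perm f))\<^sup>2) = (\<Sum>f\<in>?L. ?perm f * cnj (?perm f))"
    by (simp only: of_real_sum complex_norm_square)
  also have "\<dots> = (\<Sum>f\<in>?L. \<Sum>\<tau>\<in>?P. \<Sum>\<sigma>\<in>?P. \<Prod>j<n. U $$ (f ! j, \<tau> j) * cnj (U $$ (f ! j, \<sigma> j)))"
    unfolding perm cnj_sum cnj_prod sum_product prod.distrib ..
  also have "\<dots> = (\<Sum>\<tau>\<in>?P. \<Sum>f\<in>?L. \<Sum>\<sigma>\<in>?P. \<Prod>j<n. U $$ (f ! j, \<tau> j) * cnj (U $$ (f ! j, \<sigma> j)))"
    by (rule sum.swap)
  also have "\<dots> = (\<Sum>\<tau>\<in>?P. \<Sum>\<sigma>\<in>?P. \<Sum>f\<in>?L. \<Prod>j<n. U $$ (f ! j, \<tau> j) * cnj (U $$ (f ! j, \<sigma> j)))"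
    by (intro sum.cong refl sum.swap)
  also have "\<dots> = (\<Sum>\<tau>\<in>?P. \<Sum>\<sigma>\<in>?P. if \<sigma> = \<tau> then 1 else 0)"
  proof (intro sum.cong refl)
    fix \<tau> \<sigma> assume *: "\<tau> \<in> ?P" "\<sigma> \<in> ?P"
    have "(\<Sum>f\<in>?L. \<Prod>j<n. U $$ (f ! j, \<tau> j) * cnj (U $$ (f ! j, \<sigma> j))) =
          (\<Prod>j<n. \<Sum>x<m. U $$ (x, \<tau> j) * cnj (U $$ (x, \<sigma> j)))"
      by (rule sum_lists_prod) simp
    also have "\<dots> = (\<Prod>j<n. if \<tau> j = \<sigma> j then 1 else 0)"
    proof (intro prod.cong refl unitary_column_sum[OF U])
      fix j assume "j \<in> {..<n}"
      then have "\<tau> j \<in> {..<n}" "\<sigma> j \<in> {..<n}"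
        using * permutes_in_image[of \<tau> "{..<n}" j] permutes_in_image[of \<sigma> "{..<n}" j] by blast+
      then show "\<tau> j < m" "\<sigma> j < m" using \<open>n \<le> m\<close> by auto
    qed
    also have "\<dots> = (if \<sigma> = \<tau> then 1 else 0)"
    proof (cases "\<sigma> = \<tau>")
      case False
      then obtain j where "\<sigma> j \<noteq> \<tau> j" by auto
      moreover from this have "j < n"
        using * by (metis lessThan_iff mem_Collect_eq permutes_not_in)
      ultimately show ?thesis using False by (auto simp: prod_zero_iff)
    qed simp
    finally show "(\<Sum>f\<in>?L. \<Prod>j<n. U $$ (f ! j, \<tau> j) * cnj (U $$ (f ! j, \<sigma> j))) =
        (if \<sigma> = \<tau> then 1 else 0)" .
  qed
  also have "\<dots> = of_nat (card ?P)" using fin by (simp add: sum.delta)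
  also have "card ?P = fact n" by (rule card_permutations) auto
  finally have "complex_of_real (\<Sum>f\<in>?L. (cmod (?perm f))\<^sup>2) = complex_of_real (fact n)" by simp
  then show ?thesis by (simp only: of_real_eq_iff)
qed

lemma sum_boson_prob:
  assumes U: "U \<in> unitary_group m" and "n \<le> m"
  shows "(\<Sum>S\<in>boson_samples m n. boson_prob m n U S) = 1"
proof -
  let ?L = "{f. set f \<subseteq> {..<m} \<and> length f = n}"
  let ?perm = "\<lambda>f. permanent (Matrix.mat n n (\<lambda>(i, k). U $$ (f ! i, k)))"
  let ?type = "\<lambda>f. map (count (mset f)) [0..<m]"
  have type: "?type ` ?L \<subseteq> boson_samples m n"
  proof safe
    fix f assume f: "set f \<subseteq> {..<m}" and n: "n = length f"
    have "sum_list (?type f) = (\<Sum>x\<in>{0..<m}. count (mset f) x)"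
      by (subst interv_sum_list_conv_sum_set_nat) simp
    also have "\<dots> = (\<Sum>x\<in>set f. count (mset f) x)"
      using f by (intro sum.mono_neutral_right) (auto simp: count_eq_zero_iff)
    also have "\<dots> = length f"
      using size_multiset_overloaded_eq[of "mset f"] by simp
    finally show "?type f \<in> boson_samples m (length f)"
      by (simp add: boson_samples_def)
  qed
  have fibre: "(\<Sum>f | f \<in> ?L \<and> ?type f = S. (cmod (?perm f))\<^sup>2) = fact n * boson_prob m n U S"
    if S: "S \<in> boson_samples m n" for S
  proof -
    let ?R = "mset (row_indices S)"
    have len: "length S = m" "sum_list S = n" using S by (auto simp: boson_samples_def)
    have eq: "{f. f \<in> ?L \<and> ?type f = S} = permutations_of_multiset ?R"
    proof (intro subset_antisym subsetI)
      fix f assume "f \<in> {f. f \<in> ?L \<and> ?type f = S}"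
      then have f: "set f \<subseteq> {..<m}" "length f = n" "?type f = S" by auto
      have "count (mset f) x = count ?R x" for x
      proof (cases "x < m")
        case True
        then have "count (mset f) x = ?type f ! x" by simp
        also have "\<dots> = count ?R x"
          unfolding f(3) using True by (simp add: count_mset_row_indices[OF len(1)])
        finally show ?thesis .
      next
        case False
        then have "x \<notin> set f" using f by auto
        then show ?thesis using False
          by (simp add: count_mset_row_indices[OF len(1)] count_list_0_iff del: count_mset)
      qed
      then show "f \<in> permutations_of_multiset ?R"
        by (auto simp: permutations_of_multiset_def intro: multiset_eqI)
    next
      fix f assume "f \<in> permutations_of_multiset ?R"
      then have f: "mset f = ?R" by (simp add: permutations_of_multiset_def)
      then have "length f = n"
        using len by (metis length_row_indices size_mset)
      moreover have "x < m" if "x \<in> set f" for x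
      proof (rule ccontr)
        assume "\<not> x < m"
        then have "count (mset f) x = 0"
          unfolding f by (simp only: count_mset_row_indices[OF len(1)] if_False)
        with that show False by (simp add: count_eq_zero_iff del: count_mset)
      qed
      moreover have "?type f = S"
        unfolding f using len by (intro nth_equalityI) (simp_all add: count_mset_row_indices del: count_mset)
      ultimately show "f \<in> {f. f \<in> ?L \<and> ?type f = S}" by auto
    qed
    have "(\<Sum>f | f \<in> ?L \<and> ?type f = S. (cmod (?perm f))\<^sup>2) =
          (\<Sum>f\<in>permutations_of_multiset ?R. (cmod (?perm (row_indices S)))\<^sup>2)"
      unfolding eq
    proof (intro sum.cong refl)
      fix f assume "f \<in> permutations_of_multiset ?R"
      then have "mset f = ?R" by (simp add: permutations_of_multiset_def)
      moreover from this have "length f = n"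
        using len by (metis length_row_indices size_mset)
      ultimately show "(cmod (?perm f))\<^sup>2 = (cmod (?perm (row_indices S)))\<^sup>2"
        by (simp only: row_perm_invariant)
    qed
    also have "\<dots> = real (card (permutations_of_multiset ?R)) * (cmod (?perm (row_indices S)))\<^sup>2"
      by simp
    finally have sum: "(\<Sum>f | f \<in> ?L \<and> ?type f = S. (cmod (?perm f))\<^sup>2) = \<dots>" .
    have "(\<Prod>x\<in>set_mset ?R. fact (count ?R x)) = (\<Prod>x<m. fact (count ?R x) :: nat)"
    proof (rule prod.mono_neutral_left)
      show "set_mset ?R \<subseteq> {..<m}"
      proof
        fix x assume "x \<in> set_mset ?R"
        then have "count ?R x \<noteq> 0" by (simp only: count_eq_zero_iff not_not)
        then show "x \<in> {..<m}"
          by (simp only: count_mset_row_indices[OF len(1)] lessThan_iff split: if_splits)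
      qed
      show "\<forall>x\<in>{..<m} - set_mset ?R. fact (count ?R x) = (1 :: nat)"
        by (metis DiffD2 count_eq_zero_iff fact_0)
    qed simp
    also have "\<dots> = (\<Prod>x<m. fact (S ! x))"
      by (intro prod.cong refl) (simp only: count_mset_row_indices[OF len(1)] lessThan_iff if_True)
    finally have "(\<Prod>x\<in>set_mset ?R. fact (count ?R x)) = (\<Prod>x<m. fact (S ! x) :: nat)" .
    then have "card (permutations_of_multiset ?R) * (\<Prod>x<m. fact (S ! x)) = fact n"
      using card_permutations_of_multiset_aux[of ?R] len
      by (simp only: size_mset length_row_indices)
    then have "real (card (permutations_of_multiset ?R) * (\<Prod>x<m. fact (S ! x))) = real (fact n)"
      by (rule arg_cong)
    then have "real (card (permutations_of_multiset ?R)) * (\<Prod>x<m. fact (S ! x)) = fact n"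
      by (simp only: of_nat_mult of_nat_prod of_nat_fact)
    then have "real (card (permutations_of_multiset ?R)) = fact n / (\<Prod>x<m. fact (S ! x))"
      by (simp add: field_simps)
    with sum S show ?thesis
      by (simp add: boson_prob_def boson_submatrix_def)
  qed
  have "fact n = (\<Sum>f\<in>?L. (cmod (?perm f))\<^sup>2)"
    using sum_permanents_lists[OF assms] by simp
  also have "\<dots> = (\<Sum>S\<in>boson_samples m n. \<Sum>f | f \<in> ?L \<and> ?type f = S. (cmod (?perm f))\<^sup>2)"
    by (rule sum.group[symmetric])
       (use type finite_lists_length_eq[of "{..<m}"] finite_boson_samples in auto)
  also have "\<dots> = fact n * (\<Sum>S\<in>boson_samples m n. boson_prob m n U S)"
    unfolding sum_distrib_left by (intro sum.cong refl fibre)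
  finally show ?thesis by simp
qed

lemma pmf_boson_sampling:
  assumes "U \<in> unitary_group m" and "n \<le> m"
  shows "pmf (boson_sampling m n U) S = boson_prob m n U S"
  unfolding boson_sampling_def
proof (rule pmf_embed_pmf)
  show nonneg: "0 \<le> boson_prob m n U x" for x
    by (simp add: boson_prob_def prod_nonneg)
  have "(\<integral>\<^sup>+x. ennreal (boson_prob m n U x) \<partial>count_space UNIV) =
        (\<Sum>x\<in>boson_samples m n. ennreal (boson_prob m n U x))"
    by (rule nn_integral_count_space') (auto simp: finite_boson_samples boson_prob_def)
  also have "\<dots> = 1"
    using sum_boson_prob[OF assms] nonneg by (simp add: sum_ennreal)
  finally show "(\<integral>\<^sup>+x. ennreal (boson_prob m n U x) \<partial>count_space UNIV) = 1" .
qed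

end

theory Submission
  imports Defs "HOL-Real_Asymp.Real_Asymp"
begin

text \<open>
  On sample sequences without repetitions a symmetric algorithm cannot behave differently from one
  sequence to the next, so it can only exploit collisions; if all probabilities are at most
  \<open>exp (- n)\<close>, collisions are rare for fewer than about \<open>exp (n / 2)\<close> samples.
  The probabilities are at most \<open>(n!)\<^sup>2 t ^ n\<close> when every \<open>\<bar>U\<^sub>j\<^sub>k\<bar>\<^sup>2\<close> is at most \<open>t\<close>, which for
  \<open>t = n powr (1 + \<eta>) / m\<close> and \<open>\<eta> = (\<nu> - 3) / 2\<close> is eventually below \<open>exp (- n)\<close>.
  A Haar random \<open>U\<close> violates the entry bound with probability at most \<open>4 m n exp (- t m / 4)\<close>:
  multiplying \<open>U\<close> from the left by the discrete Fourier matrix with randomly signed columns does not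
  change its law, and turns its entries into Rademacher sums of variance \<open>1 / m\<close>.
\<close>

section \<open>Collisions among samples and symmetric algorithms\<close>

text \<open>Birthday bound by induction on \<open>l\<close>: a sample prepended to a repetition-free
  list of length \<open>l\<close> hits one of its values with probability at most
  \<open>l * e\<close>, and \<open>l\<^sup>2 / 2 + l \<le> (l + 1)\<^sup>2 / 2\<close>.\<close>

lemma prob_replicate_pmf_not_distinct:
  assumes "\<And>x. pmf P x \<le> e"
  shows "measure_pmf.prob (replicate_pmf l P) {xs. \<not> distinct xs} \<le> (real l)\<^sup>2 / 2 * e"
proof (induction l)
  case 0
  show ?case by (simp add: measure_return_pmf)
next
  case (Suc l)
  let ?R = "replicate_pmf l P" and ?N = "{xs. \<not> distinct xs}"
  have e: "e \<ge> 0" using assms[of undefined] pmf_nonneg[of P undefined] by linarith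
  \<comment> \<open>\<open>replicate_pmf\<close> draws the head first; drawing the tail first allows
    the head to be estimated for a fixed tail \<open>xs\<close>.\<close>
  have "replicate_pmf (Suc l) P = bind_pmf ?R (\<lambda>xs. map_pmf (\<lambda>x. x # xs) P)"
    by (simp add: map_pmf_def bind_commute_pmf[of P])
  then have "emeasure (replicate_pmf (Suc l) P) ?N =
      (\<integral>\<^sup>+xs. emeasure (map_pmf (\<lambda>x. x # xs) P) ?N \<partial>?R)"
    by simp
  also have "\<dots> \<le> (\<integral>\<^sup>+xs. indicator ?N xs + ennreal (real l * e) \<partial>?R)"
  proof (rule nn_integral_mono_AE, rule AE_pmfI)
    fix xs assume "xs \<in> set_pmf ?R"
    then have len: "length xs = l" by (auto simp: set_replicate_pmf)
    show "emeasure (map_pmf (\<lambda>x. x # xs) P) ?N \<le> indicator ?N xs + ennreal (real l * e)"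
    proof (cases "distinct xs")
      case True
      then have "(\<lambda>x. x # xs) -` ?N = set xs" by auto
      then have "emeasure (map_pmf (\<lambda>x. x # xs) P) ?N = ennreal (\<Sum>x\<in>set xs. pmf P x)"
        by (simp add: measure_pmf.emeasure_eq_measure measure_measure_pmf_finite)
      also have "(\<Sum>x\<in>set xs. pmf P x) \<le> real l * e"
        using sum_bounded_above[of "set xs" "pmf P" e] assms True len
        by (simp add: distinct_card)
      finally show ?thesis using True by (simp add: ennreal_leI)
    next
      case False
      have "emeasure (map_pmf (\<lambda>x. x # xs) P) ?N \<le> 1"
        by (simp add: measure_pmf.emeasure_eq_measure)
      also have "\<dots> \<le> indicator ?N xs + ennreal (real l * e)"
        using False by simp
      finally show ?thesis .
    qed
  qed
  also have "\<dots> = ennreal (measure_pmf.prob ?R ?N + real l * e)"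
    using e by (simp add: nn_integral_add measure_pmf.emeasure_eq_measure ennreal_plus)
  finally have "measure_pmf.prob (replicate_pmf (Suc l) P) ?N \<le> measure_pmf.prob ?R ?N + real l * e"
    using e by (simp add: measure_pmf.emeasure_eq_measure ennreal_le_iff del: replicate_pmf.simps ennreal_plus)
  also have "\<dots> \<le> (real l)\<^sup>2 / 2 * e + real l * e"
    using Suc.IH by simp
  also have "\<dots> \<le> (real (Suc l))\<^sup>2 / 2 * e"
    using e by (simp add: field_simps power2_eq_square)
  finally show ?case .
qed

text \<open>Matching the lists position by position is a bijection between their sets of values. The
  complements in the finite set \<open>\<Phi>\<close> have equal size, so the bijection extends to
  all of \<open>\<Phi>\<close>.\<close>

lemma permutes_map_distinct_lists:
  assumes "finite \<Phi>" "set xs \<subseteq> \<Phi>" "set ys \<subseteq> \<Phi>" "distinct xs" "distinct ys"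
    and "length xs = length ys"
  obtains \<kappa> where "\<kappa> permutes \<Phi>" "map \<kappa> xs = ys"
proof -
  define f where "f = (\<lambda>x. ys ! (THE i. i < length xs \<and> xs ! i = x))"
  have f: "f (xs ! i) = ys ! i" if "i < length xs" for i
  proof -
    have "(THE j. j < length xs \<and> xs ! j = xs ! i) = i"
      using that assms(4) by (intro the_equality) (auto simp: nth_eq_iff_index_eq)
    then show ?thesis by (simp add: f_def)
  qed
  have map: "map f xs = ys"
    using f assms(6) by (intro nth_equalityI) auto
  have bij: "bij_betw f (set xs) (set ys)"
    using map assms(5) by (auto simp: bij_betw_def inj_on_def distinct_map)
  have "card (\<Phi> - set xs) = card (\<Phi> - set ys)"
    using assms by (simp add: card_Diff_subset distinct_card)
  then obtain g where g: "bij_betw g (\<Phi> - set xs) (\<Phi> - set ys)"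
    using assms(1) finite_same_card_bij[of "\<Phi> - set xs" "\<Phi> - set ys"] by auto
  \<comment> \<open>The matching on \<open>set xs\<close>, any bijection of the complements on the
    rest of \<open>\<Phi>\<close>, and the identity outside, as \<open>permutes\<close>
    demands.\<close>
  define \<kappa> where "\<kappa> x = (if x \<in> set xs then f x else if x \<in> \<Phi> then g x else x)" for x
  have "bij_betw \<kappa> (set xs) (set ys)"
    using bij by (rule bij_betw_cong[THEN iffD1, rotated]) (simp add: \<kappa>_def)
  moreover have "bij_betw \<kappa> (\<Phi> - set xs) (\<Phi> - set ys)"
    using g by (rule bij_betw_cong[THEN iffD1, rotated]) (simp add: \<kappa>_def)
  ultimately have "bij_betw \<kappa> (set xs \<union> (\<Phi> - set xs)) (set ys \<union> (\<Phi> - set ys))"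
    by (rule bij_betw_combine) auto
  then have "bij_betw \<kappa> \<Phi> \<Phi>"
    using assms by (simp add: Un_absorb1 Un_Diff_cancel)
  then have "\<kappa> permutes \<Phi>"
    by (rule bij_imp_permutes) (use assms in \<open>auto simp: \<kappa>_def\<close>)
  moreover have "map \<kappa> xs = ys"
    using map by (auto simp: \<kappa>_def)
  ultimately show ?thesis by (rule that)
qed

lemma pmf_True_plus_False: "pmf D True + pmf D False = 1"
proof -
  have "(\<Sum>b\<in>UNIV. pmf D b) = 1" by (rule sum_pmf_eq_1) auto
  then show ?thesis by (simp add: UNIV_bool)
qed

text \<open>Relabelings of \<open>\<Phi>\<close> act transitively on the repetition-free sequences
  of a given length.\<close>

lemma symmetric_algorithm_distinct:
  assumes "finite \<Phi>" "symmetric_algorithm \<Phi> l A"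
    and "xs \<in> lists \<Phi>" "ys \<in> lists \<Phi>" "length xs = l" "length ys = l" "distinct xs" "distinct ys"
  shows "A xs = A ys"
proof -
  obtain \<kappa> where "\<kappa> permutes \<Phi>" "map \<kappa> xs = ys"
    using permutes_map_distinct_lists[of \<Phi> xs ys] assms by (auto simp: in_lists_conv_set subset_iff)
  then show ?thesis
    using assms(2,3,5) by (auto simp: symmetric_algorithm_def)
qed

text \<open>Let \<open>D\<close> be the common output distribution on repetition-free sequences.
  Acceptance under \<open>P\<close> exceeds \<open>pmf D True\<close>, and rejection under
  \<open>Q\<close> exceeds \<open>pmf D False\<close>, by at most the respective collision
  probability. Adding both gives 4/3 \<le> 1 + collisions.\<close>

lemma distinguishing_needs_collisions:
  assumes "finite \<Phi>" and sym: "symmetric_algorithm \<Phi> l A" and dist: "distinguishes l A P Q"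
    and "set_pmf P \<subseteq> \<Phi>" "set_pmf Q \<subseteq> \<Phi>"
  shows "1 / 3 \<le> measure_pmf.prob (replicate_pmf l P) {xs. \<not> distinct xs} +
                 measure_pmf.prob (replicate_pmf l Q) {xs. \<not> distinct xs}"
proof -
  \<comment> \<open>If \<open>\<Phi>\<close> has fewer than \<open>l\<close> elements, no sequence
    qualifies and any \<open>D\<close> will do.\<close>
  obtain D where D: "\<And>xs. xs \<in> lists \<Phi> \<Longrightarrow> length xs = l \<Longrightarrow> distinct xs \<Longrightarrow> A xs = D"
    using symmetric_algorithm_distinct[OF assms(1) sym] by metis
  have *: "pmf (bind_pmf (replicate_pmf l R) A) b
      \<le> pmf D b + measure_pmf.prob (replicate_pmf l R) {xs. \<not> distinct xs}"
    if "set_pmf R \<subseteq> \<Phi>" for R b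
  proof -
    let ?M = "measure_pmf (replicate_pmf l R)"
    have int: "integrable ?M (\<lambda>xs. pmf (A xs) b)"
      by (rule measure_pmf.integrable_const_bound[where B = 1]) (auto simp: pmf_le_1)
    have int': "integrable ?M (\<lambda>xs. pmf D b + indicator {xs. \<not> distinct xs} xs)"
      by (rule measure_pmf.integrable_const_bound[where B = 2])
         (auto simp: indicator_def intro!: pmf_le_1 order.trans[OF pmf_le_1])
    have "pmf (bind_pmf (replicate_pmf l R) A) b = (LINT xs|?M. pmf (A xs) b)"
      by (rule pmf_bind)
    also have "\<dots> \<le> (LINT xs|?M. pmf D b + indicator {xs. \<not> distinct xs} xs)"
    proof (rule integral_mono_AE[OF int int'], rule AE_pmfI)
      fix xs assume "xs \<in> set_pmf (replicate_pmf l R)"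
      then have "xs \<in> lists \<Phi>" "length xs = l"
        using that by (auto simp: set_replicate_pmf)
      then show "pmf (A xs) b \<le> pmf D b + indicator {xs. \<not> distinct xs} xs"
        using D[of xs] by (cases "distinct xs") (auto intro: add_increasing pmf_le_1)
    qed
    also have "\<dots> = pmf D b + measure_pmf.prob (replicate_pmf l R) {xs. \<not> distinct xs}"
      by (subst Bochner_Integration.integral_add)
         (auto intro: measure_pmf.integrable_const_bound[where B = 1])
    finally show ?thesis .
  qed
  show ?thesis
    using *[of P True] *[of Q False] assms(4,5) dist pmf_True_plus_False[of D]
    unfolding distinguishes_def by linarith
qed

text \<open>The mass of \<open>P\<close> is 1 and sits on \<open>\<Phi>\<close>, so
  \<open>1 / card \<Phi> \<le> e\<close>. Hence \<open>e\<close> bounds the uniform probabilities as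
  well, and each of the two collision probabilities is at most
  \<open>l\<^sup>2 / 2 * e\<close>.\<close>

lemma sample_lower_bound:
  assumes "finite \<Phi>" "symmetric_algorithm \<Phi> l A" "distinguishes l A P (pmf_of_set \<Phi>)"
    and P: "set_pmf P \<subseteq> \<Phi>" and e: "\<And>x. pmf P x \<le> e"
  shows "1 / 3 \<le> (real l)\<^sup>2 * e"
proof -
  have ne: "\<Phi> \<noteq> {}" using P set_pmf_not_empty[of P] by blast
  have "1 = (\<Sum>x\<in>\<Phi>. pmf P x)"
    using sum_pmf_eq_1[OF assms(1) P] by simp
  also have "\<dots> \<le> real (card \<Phi>) * e"
    using sum_bounded_above[of \<Phi> "pmf P" e] e by simp
  finally have "1 / real (card \<Phi>) \<le> e"
    using ne assms(1) by (simp add: field_simps card_gt_0_iff)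
  moreover have "0 \<le> e" using e[of undefined] pmf_nonneg[of P undefined] by linarith
  ultimately have "pmf (pmf_of_set \<Phi>) x \<le> e" for x
    using ne assms(1) by (simp add: indicator_def)
  then show ?thesis
    using distinguishing_needs_collisions[OF assms(1-3) P] ne assms(1)
      prob_replicate_pmf_not_distinct[of P e l] prob_replicate_pmf_not_distinct[of "pmf_of_set \<Phi>" e l] e
    by simp
qed

section \<open>Measurability of the distinguishability event\<close>

text \<open>Projection along a compact factor is a closed map, so an existential quantifier over a
  compact set preserves closedness.\<close>

lemma closed_projection_along_compact:
  fixes C :: "('a::topological_space \<times> 'b::topological_space) set"
  assumes "compact K" "closed C"
  shows "closed {x. \<exists>y\<in>K. (x, y) \<in> C}"
proof -
  let ?T = "prod_topology (euclidean :: 'a topology) (top_of_set K)"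
  \<comment> \<open>\<open>K\<close> is treated as a compact space in its own right, so that the
    projection from \<open>?T\<close> is a closed map.\<close>
  have "?T = top_of_set (UNIV \<times> K)"
    using prod_topology_subtopology(2)[of euclidean euclidean K]
    by (simp add: prod_topology_euclidean)
  then have "closedin ?T (UNIV \<times> K \<inter> C)"
    using assms(2) by (simp add: closedin_closed_Int)
  moreover have "closed_map ?T euclidean fst"
    using assms(1) by (intro Abstract_Topological_Spaces.closed_map_fst)
       (simp add: compact_space_subtopology)
  ultimately have "closed (fst ` (UNIV \<times> K \<inter> C))"
    by (simp add: closed_map_def)
  also have "fst ` (UNIV \<times> K \<inter> C) = {x. \<exists>y\<in>K. (x, y) \<in> C}"
    by force
  finally show ?thesis .
qed

text \<open>Tychonoff's theorem, transferred to the topology of the function type.\<close>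

lemma compact_PiE_UNIV:
  assumes "compact K"
  shows "compact (PiE UNIV (\<lambda>_ :: 'a. K :: 'b::topological_space set))"
proof -
  have "compactin (product_topology (\<lambda>_. euclidean) UNIV) (PiE (UNIV :: 'a set) (\<lambda>_. K))"
    using assms by (simp add: compactin_PiE)
  then show ?thesis by (simp add: euclidean_product_topology)
qed

lemma pmf_replicate_pmf:
  "pmf (replicate_pmf l P) xs = (if length xs = l then \<Prod>i<l. pmf P (xs ! i) else 0)"
proof (induction l arbitrary: xs)
  case 0
  then show ?case by (auto simp: indicator_def)
next
  case (Suc l)
  have eq: "replicate_pmf (Suc l) P = map_pmf (\<lambda>(x, xs). x # xs) (pair_pmf P (replicate_pmf l P))"
    by (simp add: pair_pmf_def map_pmf_def bind_assoc_pmf bind_return_pmf)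
  show ?case
  proof (cases xs)
    case Nil
    then have "xs \<notin> set_pmf (replicate_pmf (Suc l) P)"
      by (simp add: set_replicate_pmf del: replicate_pmf.simps)
    then show ?thesis using Nil by (simp add: set_pmf_iff del: replicate_pmf.simps)
  next
    case (Cons y ys)
    have "pmf (replicate_pmf (Suc l) P) (y # ys) = pmf P y * pmf (replicate_pmf l P) ys"
      unfolding eq using pmf_map_inj'[of "\<lambda>(x, xs). x # xs" "pair_pmf P (replicate_pmf l P)" "(y, ys)"]
      by (simp add: inj_on_def pmf_pair)
    then show ?thesis
      using Suc.IH[of ys] Cons by (simp add: prod.lessThan_Suc_shift del: replicate_pmf.simps prod.lessThan_Suc)
  qed
qed

text \<open>As a finite sum, the output probability is a polynomial in the point masses of
  \<open>P\<close> and linear in those of \<open>A\<close>; this supplies the continuity behind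
  \<open>closed_distinguishable\<close>.\<close>

lemma pmf_bind_replicate_pmf:
  assumes "finite \<Phi>" "set_pmf P \<subseteq> \<Phi>"
  shows "pmf (bind_pmf (replicate_pmf l P) A) b =
    (\<Sum>xs | set xs \<subseteq> \<Phi> \<and> length xs = l. (\<Prod>i<l. pmf P (xs ! i)) * pmf (A xs) b)"
proof -
  let ?L = "{xs. set xs \<subseteq> \<Phi> \<and> length xs = l}"
  have "pmf (bind_pmf (replicate_pmf l P) A) b =
      (LINT xs|measure_pmf (replicate_pmf l P). pmf (A xs) b)"
    by (rule pmf_bind)
  also have "\<dots> = (\<Sum>xs\<in>?L. pmf (A xs) b * pmf (replicate_pmf l P) xs)"
    using assms
    by (intro integral_measure_pmf_real finite_lists_length_eq) (auto simp: set_replicate_pmf)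
  finally show ?thesis
    by (auto simp: pmf_replicate_pmf mult.commute intro!: sum.cong)
qed

text \<open>Here \<open>f xs\<close> stands for the acceptance probability
  \<open>pmf (A xs) True\<close>. Symmetry thereby becomes a system of equations between coordinates
  of a point of a product space.\<close>

definition symmetric_test :: "'a set \<Rightarrow> nat \<Rightarrow> ('a list \<Rightarrow> real) \<Rightarrow> bool" where
  "symmetric_test \<Phi> l f \<longleftrightarrow>
     (\<forall>xs\<in>lists \<Phi>. length xs = l \<longrightarrow>
        (\<forall>\<tau>. \<tau> permutes {..<l} \<longrightarrow> f (permute_list \<tau> xs) = f xs) \<and>
        (\<forall>\<kappa>. \<kappa> permutes \<Phi> \<longrightarrow> f (map \<kappa> xs) = f xs))"

text \<open>
  Distinguishability by real-valued acceptance functions. Since these range over a compact set,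
  it is a closed condition on \<open>p\<close>, which makes the event in the theorem measurable.
\<close>

definition distinguishable :: "'a set \<Rightarrow> nat \<Rightarrow> ('a \<Rightarrow> real) \<Rightarrow> ('a \<Rightarrow> real) \<Rightarrow> bool" where
  "distinguishable \<Phi> l p q \<longleftrightarrow> (\<exists>f\<in>PiE UNIV (\<lambda>_. {0..1}).
     symmetric_test \<Phi> l f \<and>
     (\<Sum>xs | set xs \<subseteq> \<Phi> \<and> length xs = l. (\<Prod>i<l. p (xs ! i)) * f xs) \<ge> 2 / 3 \<and>
     (\<Sum>xs | set xs \<subseteq> \<Phi> \<and> length xs = l. (\<Prod>i<l. q (xs ! i)) * (1 - f xs)) \<ge> 2 / 3)"

text \<open>Symmetry of \<open>f\<close> consists of equations between coordinates, and the two
  thresholds are inequalities between continuous functions of \<open>(p, f)\<close>. The closed set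
  of such pairs is projected along the compact cube in which \<open>f\<close> ranges.\<close>

lemma closed_distinguishable: "closed {p. distinguishable \<Phi> l p q}"
proof -
  let ?acc = "\<lambda>p f. (\<Sum>xs | set xs \<subseteq> \<Phi> \<and> length xs = l. (\<Prod>i<l. p (xs ! i)) * f xs) \<ge> 2 / 3"
  let ?rej = "\<lambda>f. (\<Sum>xs | set xs \<subseteq> \<Phi> \<and> length xs = l. (\<Prod>i<l. q (xs ! i)) * (1 - f xs)) \<ge> 2 / 3"
  have f: "continuous_on UNIV (\<lambda>z :: ('a \<Rightarrow> real) \<times> ('a list \<Rightarrow> real). snd z xs)" for xs
    by (rule continuous_on_product_then_coordinatewise) (rule continuous_on_snd[OF continuous_on_id])
  have p: "continuous_on UNIV (\<lambda>z :: ('a \<Rightarrow> real) \<times> ('a list \<Rightarrow> real). fst z x)" for x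
    by (rule continuous_on_product_then_coordinatewise) (rule continuous_on_fst[OF continuous_on_id])
  have "closed {z. symmetric_test \<Phi> l (snd z) \<and> ?acc (fst z) (snd z) \<and> ?rej (snd z)}"
    unfolding symmetric_test_def Ball_def
    by (intro closed_Collect_conj closed_Collect_all closed_Collect_imp open_Collect_const
          closed_Collect_eq closed_Collect_le continuous_intros f p)
  from closed_projection_along_compact[OF compact_PiE_UNIV[OF compact_Icc] this]
  show ?thesis by (simp add: distinguishable_def)
qed

text \<open>A distribution on \<open>bool\<close> is determined by its mass at \<open>True\<close>:
  an algorithm yields its acceptance function, and a function with values in [0, 1] yields a
  Bernoulli algorithm.\<close>

lemma ex_distinguishing_iff:
  assumes fin: "finite \<Phi>" and P: "set_pmf P \<subseteq> \<Phi>" and Q: "set_pmf Q \<subseteq> \<Phi>"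
  shows "(\<exists>A. symmetric_algorithm \<Phi> l A \<and> distinguishes l A P Q) \<longleftrightarrow>
    distinguishable \<Phi> l (pmf P) (pmf Q)"
    (is "?L \<longleftrightarrow> ?R")
proof
  assume ?L
  then obtain A where A: "symmetric_algorithm \<Phi> l A" "distinguishes l A P Q" by blast
  have "pmf (A xs) False = 1 - pmf (A xs) True" for xs
    using pmf_True_plus_False[of "A xs"] by simp
  with A(2) have "(\<Sum>xs | set xs \<subseteq> \<Phi> \<and> length xs = l. (\<Prod>i<l. pmf P (xs ! i)) * pmf (A xs) True) \<ge> 2 / 3"
     "(\<Sum>xs | set xs \<subseteq> \<Phi> \<and> length xs = l. (\<Prod>i<l. pmf Q (xs ! i)) * (1 - pmf (A xs) True)) \<ge> 2 / 3"
    by (simp_all only: distinguishes_def pmf_bind_replicate_pmf[OF fin P] pmf_bind_replicate_pmf[OF fin Q])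
  moreover have "symmetric_test \<Phi> l (\<lambda>xs. pmf (A xs) True)"
    using A(1) unfolding symmetric_test_def symmetric_algorithm_def by metis
  moreover have "(\<lambda>xs. pmf (A xs) True) \<in> PiE UNIV (\<lambda>_. {0..1})"
    by (auto simp: pmf_le_1)
  ultimately show ?R
    unfolding distinguishable_def by blast
next
  assume ?R
  then obtain f where f: "f \<in> PiE UNIV (\<lambda>_. {0..1})"
     "symmetric_test \<Phi> l f"
     "(\<Sum>xs | set xs \<subseteq> \<Phi> \<and> length xs = l. (\<Prod>i<l. pmf P (xs ! i)) * f xs) \<ge> 2 / 3"
     "(\<Sum>xs | set xs \<subseteq> \<Phi> \<and> length xs = l. (\<Prod>i<l. pmf Q (xs ! i)) * (1 - f xs)) \<ge> 2 / 3"
    unfolding distinguishable_def by blast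
  have f01: "0 \<le> f xs" "f xs \<le> 1" for xs
    using PiE_mem[OF f(1), of xs] by auto
  let ?A = "\<lambda>xs. bernoulli_pmf (f xs)"
  have "symmetric_algorithm \<Phi> l ?A"
    using f(2) unfolding symmetric_test_def symmetric_algorithm_def by metis
  moreover have "distinguishes l ?A P Q"
    using f(3,4) unfolding distinguishes_def
    by (simp only: pmf_bind_replicate_pmf[OF fin P] pmf_bind_replicate_pmf[OF fin Q]
          pmf_bernoulli_True[OF f01] pmf_bernoulli_False[OF f01] simp_thms)
  ultimately show ?L by blast
qed

text \<open>The event is the preimage of a closed set under the map from \<open>U\<close> to
  \<open>pmf (P U)\<close>. Countability of \<open>'a\<close> makes this map Borel measurable as
  soon as its coordinates are.\<close>

lemma sets_ex_distinguishing:
  fixes \<Phi> :: "'a :: countable set"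
  assumes "finite \<Phi>" "set_pmf Q \<subseteq> \<Phi>"
    and P: "\<And>U. U \<in> space M \<Longrightarrow> set_pmf (P U) \<subseteq> \<Phi>"
    and meas: "\<And>x. (\<lambda>U. pmf (P U) x) \<in> borel_measurable M"
  shows "{U \<in> space M. \<exists>A. symmetric_algorithm \<Phi> l A \<and> distinguishes l A (P U) Q} \<in> sets M"
proof -
  have "(\<lambda>U. pmf (P U)) \<in> borel_measurable M"
    by (rule measurable_coordinatewise_then_product) (rule meas)
  from measurable_sets[OF this borel_closed[OF closed_distinguishable[of \<Phi> l "pmf Q"]]]
  have "{U \<in> space M. distinguishable \<Phi> l (pmf (P U)) (pmf Q)} \<in> sets M"
    by (simp add: vimage_def Int_def conj_commute)
  moreover have "(\<exists>A. symmetric_algorithm \<Phi> l A \<and> distinguishes l A (P U) Q) \<longleftrightarrow>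
      distinguishable \<Phi> l (pmf (P U)) (pmf Q)" if "U \<in> space M" for U
    by (rule ex_distinguishing_iff[OF assms(1) P[OF that] assms(2)])
  ultimately show ?thesis by (simp cong: conj_cong)
qed

section \<open>Exponential tails of Rademacher sums\<close>

text \<open>Termwise comparison of power series: the odd terms on the left cancel, and
  \<open>2 ^ k * fact k \<le> fact (2 * k)\<close> handles the even ones.\<close>

lemma cosh_le_exp_sq:
  fixes x :: real
  shows "exp x + exp (- x) \<le> 2 * exp (x\<^sup>2 / 2)"
proof -
  \<comment> \<open>Grouping terms in pairs leaves one even and one odd power in each block.\<close>
  have "(\<lambda>k. \<Sum>i\<in>{k*2..<k*2+2}. x ^ i /\<^sub>R fact i + (-x) ^ i /\<^sub>R fact i) sums (exp x + exp (-x))"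
    by (rule sums_group) (use sums_add[OF exp_converges[of x] exp_converges[of "-x"]] in auto)
  moreover have "(\<Sum>i\<in>{k*2..<k*2+2}. x ^ i /\<^sub>R fact i + (-x) ^ i /\<^sub>R fact i) = 2 * ((x\<^sup>2) ^ k / fact (2 * k))" for k
  proof -
    have "{k*2..<k*2+2} = {2*k, Suc (2*k)}" by auto
    moreover have "(-x) ^ (2 * k) = x ^ (2 * k)" "(-x) ^ Suc (2 * k) = - (x ^ Suc (2 * k))"
      by simp_all
    ultimately show ?thesis
      by (simp add: power_mult power2_eq_square power_mult_distrib divide_inverse mult.commute
          del: power_Suc fact_Suc)
  qed
  ultimately have "(\<lambda>k. 2 * ((x\<^sup>2) ^ k / fact (2 * k))) sums (exp x + exp (-x))" by simp
  moreover have "(\<lambda>k. 2 * ((x\<^sup>2 / 2) ^ k /\<^sub>R fact k)) sums (2 * exp (x\<^sup>2 / 2))"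
    by (intro sums_mult exp_converges)
  moreover have "2 * ((x\<^sup>2) ^ k / fact (2 * k)) \<le> 2 * ((x\<^sup>2 / 2) ^ k /\<^sub>R fact k)" for k
  proof -
    have "(2::real) ^ k * fact k \<le> fact (2 * k)"
    proof (induction k)
      case (Suc k)
      have "(2::real) ^ Suc k * fact (Suc k) = (2 * (real k + 1)) * (2 ^ k * fact k)" by simp
      also have "\<dots> \<le> ((2 * real k + 2) * (2 * real k + 1)) * fact (2 * k)"
        using Suc by (intro mult_mono) auto
      also have "\<dots> = fact (2 * Suc k)" by (simp add: algebra_simps)
      finally show ?case .
    qed simp
    then have "(x\<^sup>2) ^ k / fact (2 * k) \<le> (x\<^sup>2) ^ k / (2 ^ k * fact k)"
      by (intro divide_left_mono) auto
    then show ?thesis by (simp add: power_divide field_simps)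
  qed
  ultimately show ?thesis by (rule sums_le[rotated])
qed

text \<open>Counting in this set replaces probabilities of random signs, up to the factor
  \<open>2 ^ m\<close>. The list encoding lets \<open>sum_lists_prod\<close> factor exponential
  moments.\<close>

definition sign_lists :: "nat \<Rightarrow> real list set" where
  "sign_lists m = {e. set e \<subseteq> {-1, 1} \<and> length e = m}"

lemma finite_sign_lists: "finite (sign_lists m)"
  unfolding sign_lists_def by (rule finite_lists_length_eq) simp

lemma card_sign_lists: "card (sign_lists m) = 2 ^ m"
  unfolding sign_lists_def by (subst card_lists_length_eq) (simp_all add: numeral_2_eq_2)

lemma nth_sign_lists: "e \<in> sign_lists m \<Longrightarrow> i < m \<Longrightarrow> e ! i = -1 \<or> e ! i = 1"
  by (auto simp: sign_lists_def subset_iff in_set_conv_nth)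

text \<open>Chernoff's method for the counting measure: the exponential moment factors over the
  signs, and \<open>cosh_le_exp_sq\<close> bounds each factor.\<close>

lemma card_sign_sum_gt:
  fixes b :: "nat \<Rightarrow> real"
  assumes b: "(\<Sum>i<m. (b i)\<^sup>2) \<le> v" and v: "v > 0" and r: "r \<ge> 0"
  shows "real (card {e \<in> sign_lists m. (\<Sum>i<m. e ! i * b i) > r}) \<le> 2 ^ m * exp (- r\<^sup>2 / (2 * v))"
proof -
  \<comment> \<open>The minimizer of \<open>- s * r + s\<^sup>2 / 2 * v\<close>, the exponent
    reached at the end.\<close>
  define s where "s = r / v"
  have s: "s \<ge> 0" using r v by (simp add: s_def)
  let ?E = "{e \<in> sign_lists m. (\<Sum>i<m. e ! i * b i) > r}"
  have "real (card ?E) = (\<Sum>e\<in>?E. 1)" by simp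
  also have "\<dots> \<le> (\<Sum>e\<in>?E. exp (s * ((\<Sum>i<m. e ! i * b i) - r)))"
    using s by (intro sum_mono) auto
  also have "\<dots> \<le> (\<Sum>e\<in>sign_lists m. exp (s * ((\<Sum>i<m. e ! i * b i) - r)))"
    by (rule sum_mono2) (auto simp: finite_sign_lists)
  also have "\<dots> = exp (- s * r) * (\<Sum>e\<in>sign_lists m. \<Prod>i<m. exp (s * b i * e ! i))"
    unfolding sum_distrib_left
    by (intro sum.cong refl)
       (simp add: exp_sum[symmetric] mult_exp_exp sum_distrib_left algebra_simps)
  also have "(\<Sum>e\<in>sign_lists m. \<Prod>i<m. exp (s * b i * e ! i)) =
      (\<Prod>i<m. \<Sum>x\<in>{-1, 1}. exp (s * b i * x))"
    unfolding sign_lists_def by (rule sum_lists_prod) simp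
  also have "\<dots> \<le> (\<Prod>i<m. 2 * exp ((s * b i)\<^sup>2 / 2))"
    using cosh_le_exp_sq[of "s * b _"] by (intro prod_mono) (auto simp: add_nonneg_nonneg add.commute)
  also have "\<dots> = 2 ^ m * exp (s\<^sup>2 / 2 * (\<Sum>i<m. (b i)\<^sup>2))"
    by (simp add: prod.distrib exp_sum[symmetric] sum_distrib_left power_mult_distrib)
  also have "\<dots> \<le> 2 ^ m * exp (s\<^sup>2 / 2 * v)"
    using b by (intro mult_left_mono) (auto intro!: mult_left_mono)
  also have "exp (- s * r) * (2 ^ m * exp (s\<^sup>2 / 2 * v)) = 2 ^ m * exp (- r\<^sup>2 / (2 * v))"
  proof -
    have "- s * r + s\<^sup>2 / 2 * v = - r\<^sup>2 / (2 * v)"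
      using v by (simp add: s_def field_simps power2_eq_square)
    then show ?thesis by (simp add: mult_exp_exp)
  qed
  finally show ?thesis by simp
qed

text \<open>If the squared modulus exceeds \<open>t\<close>, the real or the imaginary part exceeds
  \<open>sqrt (t / 2)\<close> in absolute value. This gives four one-sided events, hence the factor
  4, each with exponent \<open>- (t / 2) / (2 * v)\<close>.\<close>

lemma card_sign_cmod_gt:
  fixes w :: "nat \<Rightarrow> complex"
  assumes w: "(\<Sum>i<m. (cmod (w i))\<^sup>2) \<le> v" and v: "v > 0" and t: "t \<ge> 0"
  shows "real (card {e \<in> sign_lists m. (cmod (\<Sum>i<m. complex_of_real (e ! i) * w i))\<^sup>2 > t})
           \<le> 4 * 2 ^ m * exp (- t / (4 * v))"
proof -
  define r where "r = sqrt (t / 2)"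
  have r: "r \<ge> 0" "r\<^sup>2 = t / 2" using t by (auto simp: r_def)
  define E where "E b = {e \<in> sign_lists m. (\<Sum>i<m. e ! i * b i) > r}" for b
  have E: "real (card (E b)) \<le> 2 ^ m * exp (- t / (4 * v))"
    if "\<And>i. (b i)\<^sup>2 \<le> (cmod (w i))\<^sup>2" for b
  proof -
    have "(\<Sum>i<m. (b i)\<^sup>2) \<le> v"
      using that w by (meson order_trans sum_mono)
    from card_sign_sum_gt[OF this v r(1)] show ?thesis
      unfolding r(2) E_def by (simp add: field_simps)
  qed
  have fin: "finite (E b)" for b unfolding E_def by (simp add: finite_sign_lists)
  let ?R = "\<lambda>i. Re (w i)" and ?I = "\<lambda>i. Im (w i)"
  have "{e \<in> sign_lists m. (cmod (\<Sum>i<m. complex_of_real (e ! i) * w i))\<^sup>2 > t}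
      \<subseteq> E ?R \<union> E (\<lambda>i. - ?R i) \<union> E ?I \<union> E (\<lambda>i. - ?I i)"
  proof safe
    fix e assume e: "e \<in> sign_lists m" "(cmod (\<Sum>i<m. complex_of_real (e ! i) * w i))\<^sup>2 > t"
      and n: "e \<notin> E (\<lambda>i. - ?I i)" "e \<notin> E ?I" "e \<notin> E (\<lambda>i. - ?R i)"
    define x where "x = (\<Sum>i<m. e ! i * ?R i)"
    define y where "y = (\<Sum>i<m. e ! i * ?I i)"
    \<comment> \<open>Three of the four events are assumed to fail:
      \<open>\<bar>y\<bar> \<le> r\<close> leaves more than \<open>t / 2\<close> for
      \<open>x\<^sup>2\<close>, and \<open>- x \<le> r\<close> then fixes the sign of
      \<open>x\<close>.\<close>
    have "t < x\<^sup>2 + y\<^sup>2"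
      using e(2) by (simp add: cmod_power2 x_def y_def)
    moreover have "\<bar>y\<bar> \<le> r" "- x \<le> r"
      using n e(1) by (auto simp: E_def x_def y_def sum_negf)
    moreover have "y\<^sup>2 \<le> r\<^sup>2"
      using \<open>\<bar>y\<bar> \<le> r\<close> r(1) by (simp add: abs_le_square_iff[symmetric])
    ultimately have "x\<^sup>2 > r\<^sup>2" using r(2) by linarith
    then have "\<bar>x\<bar> > r" using r(1) by (metis abs_ge_zero abs_of_nonneg abs_square_less_1 abs_le_square_iff not_le)
    then have "x > r" using \<open>- x \<le> r\<close> by linarith
    then show "e \<in> E ?R" using e(1) by (simp add: E_def x_def)
  qed
  then have "card {e \<in> sign_lists m. (cmod (\<Sum>i<m. complex_of_real (e ! i) * w i))\<^sup>2 > t}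
      \<le> card (E ?R \<union> E (\<lambda>i. - ?R i) \<union> E ?I \<union> E (\<lambda>i. - ?I i))"
    by (intro card_mono) (auto simp: fin)
  also have "\<dots> \<le> card (E ?R) + card (E (\<lambda>i. - ?R i)) + card (E ?I) + card (E (\<lambda>i. - ?I i))"
    by (meson add_le_mono1 card_Un_le order_trans)
  finally have "real (card {e \<in> sign_lists m. (cmod (\<Sum>i<m. complex_of_real (e ! i) * w i))\<^sup>2 > t})
      \<le> real (card (E ?R)) + real (card (E (\<lambda>i. - ?R i))) + real (card (E ?I)) + real (card (E (\<lambda>i. - ?I i)))"
    by linarith
  also have "\<dots> \<le> 4 * 2 ^ m * exp (- t / (4 * v))"
    using E[of ?R] E[of "\<lambda>i. - ?R i"] E[of ?I] E[of "\<lambda>i. - ?I i"]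
    by (simp add: cmod_power2)
  finally show ?thesis .
qed

section \<open>Entries of a Haar random unitary matrix\<close>

lemma space_unitary_borel [simp]: "space (unitary_borel m) = unitary_group m"
  by (simp add: unitary_borel_def)

lemma unitary_group_carrier: "U \<in> unitary_group m \<Longrightarrow> U \<in> carrier_mat m m"
  by (simp add: unitary_group_def)

lemma measurable_unitary_entry:
  assumes "i < m" "j < m"
  shows "(\<lambda>U. U $$ (i, j)) \<in> borel_measurable (unitary_borel m)"
proof -
  let ?I = "{..<m} \<times> {..<m}"
  have "(\<lambda>U. \<lambda>p\<in>?I. U $$ p) \<in> measurable (unitary_borel m) (Pi\<^sub>M ?I (\<lambda>_. borel))"
    unfolding unitary_borel_def by (rule measurable_vimage_algebra1) (auto simp: space_PiM)
  from measurable_compose[OF this measurable_component_singleton[of "(i, j)"]] assms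
  show ?thesis by simp
qed

lemma sets_unitary_entry_gt:
  assumes "n \<le> m"
  shows "{U \<in> unitary_group m. \<exists>j<m. \<exists>k<n. (cmod (U $$ (j, k)))\<^sup>2 > t} \<in> sets (unitary_borel m)"
proof -
  have meas: "(\<lambda>U. (cmod (U $$ (j, k)))\<^sup>2) \<in> borel_measurable (unitary_borel m)" if "j < m" "k < n" for j k
    using that assms by (intro borel_measurable_power measurable_compose[OF measurable_unitary_entry borel_measurable_norm]) auto
  have "{U \<in> space (unitary_borel m). (cmod (U $$ (j, k)))\<^sup>2 > t} \<in> sets (unitary_borel m)"
    if "j < m" "k < n" for j k
    by (rule borel_measurable_less[OF borel_measurable_const meas[OF that]])
  then have "(\<Union>j\<in>{..<m}. \<Union>k\<in>{..<n}. {U \<in> unitary_group m. (cmod (U $$ (j, k)))\<^sup>2 > t}) \<in> sets (unitary_borel m)"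
    by (intro sets.finite_UN finite_lessThan) auto
  then show ?thesis
    by (rule back_subst[of "\<lambda>X. X \<in> sets (unitary_borel m)"]) auto
qed

lemma unitary_group_iff:
  "U \<in> unitary_group m \<longleftrightarrow> U \<in> carrier_mat m m \<and>
     (\<forall>p<m. \<forall>q<m. (\<Sum>x<m. U $$ (x, p) * cnj (U $$ (x, q))) = (if p = q then 1 else 0))"
proof (intro iffI conjI allI impI)
  fix p q assume "U \<in> unitary_group m" "p < m" "q < m"
  then show "(\<Sum>x<m. U $$ (x, p) * cnj (U $$ (x, q))) = (if p = q then 1 else 0)"
    by (rule unitary_column_sum)
next
  assume *: "U \<in> carrier_mat m m \<and>
     (\<forall>p<m. \<forall>q<m. (\<Sum>x<m. U $$ (x, p) * cnj (U $$ (x, q))) = (if p = q then 1 else 0))"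
  then have U: "U \<in> carrier_mat m m" by blast
  have "mat_adjoint U * U = 1\<^sub>m m"
  proof (rule eq_matI)
    fix q p assume "q < dim_row (1\<^sub>m m :: complex mat)" "p < dim_col (1\<^sub>m m :: complex mat)"
    then have qp: "q < m" "p < m" by auto
    have "(mat_adjoint U * U) $$ (q, p) = (\<Sum>x<m. cnj (U $$ (x, q)) * U $$ (x, p))"
      using U qp by (simp add: mat_adjoint_def scalar_prod_def atLeast0LessThan)
    then show "(mat_adjoint U * U) $$ (q, p) = 1\<^sub>m m $$ (q, p)"
      using * qp by (simp add: mult.commute)
  qed (use U in \<open>auto simp: mat_adjoint_def\<close>)
  with U show "U \<in> unitary_group m" by (simp add: unitary_group_def)
qed (simp add: unitary_group_carrier)

lemma unitary_group_mult:
  assumes V: "V \<in> unitary_group m" and U: "U \<in> unitary_group m"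
  shows "V * U \<in> unitary_group m"
proof -
  note c = unitary_group_carrier[OF V] unitary_group_carrier[OF U]
  have "(\<Sum>x<m. (V * U) $$ (x, p) * cnj ((V * U) $$ (x, q))) = (if p = q then 1 else 0)"
    if pq: "p < m" "q < m" for p q
  proof -
    have "(\<Sum>x<m. (V * U) $$ (x, p) * cnj ((V * U) $$ (x, q))) =
        (\<Sum>x<m. (\<Sum>i<m. V $$ (x, i) * U $$ (i, p)) * (\<Sum>j<m. cnj (V $$ (x, j)) * cnj (U $$ (j, q))))"
      using c pq by (intro sum.cong refl) (simp add: scalar_prod_def atLeast0LessThan)
    also have "\<dots> = (\<Sum>x<m. \<Sum>i<m. \<Sum>j<m. (U $$ (i, p) * cnj (U $$ (j, q))) * (V $$ (x, i) * cnj (V $$ (x, j))))"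
      by (simp add: sum_product mult_ac)
    also have "\<dots> = (\<Sum>i<m. \<Sum>x<m. \<Sum>j<m. (U $$ (i, p) * cnj (U $$ (j, q))) * (V $$ (x, i) * cnj (V $$ (x, j))))"
      by (rule sum.swap)
    also have "\<dots> = (\<Sum>i<m. \<Sum>j<m. \<Sum>x<m. (U $$ (i, p) * cnj (U $$ (j, q))) * (V $$ (x, i) * cnj (V $$ (x, j))))"
      by (intro sum.cong refl sum.swap)
    also have "\<dots> = (\<Sum>i<m. \<Sum>j<m. (U $$ (i, p) * cnj (U $$ (j, q))) * (if i = j then 1 else 0))"
      by (intro sum.cong refl)
         (simp add: sum_distrib_left[symmetric] unitary_column_sum[OF V] del: mult_cancel_left)
    also have "\<dots> = (\<Sum>i<m. U $$ (i, p) * cnj (U $$ (i, q)))"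
      by (intro sum.cong refl) (simp add: if_distrib[of "(*) _"] sum.delta cong: if_cong)
    also have "\<dots> = (if p = q then 1 else 0)"
      by (rule unitary_column_sum[OF U pq])
    finally show ?thesis .
  qed
  then show ?thesis
    using c by (auto simp: unitary_group_iff)
qed

text \<open>The entries of \<open>V * U\<close> are linear combinations of entries of
  \<open>U\<close>. Measurability is what turns the invariance of \<open>distr\<close> into equal
  measures of preimages.\<close>

lemma measurable_unitary_mult:
  assumes V: "V \<in> unitary_group m"
  shows "(\<lambda>U. V * U) \<in> measurable (unitary_borel m) (unitary_borel m)"
proof -
  let ?I = "{..<m} \<times> {..<m}"
  have "(\<lambda>U. V * U) \<in> measurable (unitary_borel m)
     (vimage_algebra (unitary_group m) (\<lambda>U. \<lambda>p\<in>?I. U $$ p) (Pi\<^sub>M ?I (\<lambda>_. borel)))"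
  proof (rule measurable_vimage_algebra2)
    show "(*) V \<in> space (unitary_borel m) \<rightarrow> unitary_group m"
      using unitary_group_mult[OF V] by auto
    show "(\<lambda>U. \<lambda>p\<in>?I. (V * U) $$ p) \<in> measurable (unitary_borel m) (Pi\<^sub>M ?I (\<lambda>_. borel))"
    proof (rule measurable_restrict)
      fix p assume "p \<in> ?I"
      then obtain i j where p: "p = (i, j)" "i < m" "j < m" by auto
      have "(\<lambda>U. \<Sum>x<m. V $$ (i, x) * U $$ (x, j)) \<in> borel_measurable (unitary_borel m)"
        using p by (intro borel_measurable_sum borel_measurable_times measurable_unitary_entry) auto
      moreover have "(V * U) $$ p = (\<Sum>x<m. V $$ (i, x) * U $$ (x, j))"
        if "U \<in> space (unitary_borel m)" for U
        using that p unitary_group_carrier[of U m] unitary_group_carrier[OF V]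
        by (simp add: scalar_prod_def atLeast0LessThan)
      ultimately show "(\<lambda>U. (V * U) $$ p) \<in> borel_measurable (unitary_borel m)"
        by (subst measurable_cong) auto
    qed
  qed
  then show ?thesis unfolding unitary_borel_def .
qed

text \<open>The unitary discrete Fourier matrix times the diagonal matrix of the signs
  \<open>e\<close>. Column \<open>i\<close> consists of the powers of one root of unity, so inner
  products of columns are geometric sums.\<close>

definition fourier_sign_matrix :: "nat \<Rightarrow> real list \<Rightarrow> complex mat" where
  "fourier_sign_matrix m e = Matrix.mat m m (\<lambda>(j, i).
     of_real (e ! i) * cis (2 * pi * real i / real m) ^ j / of_real (sqrt (real m)))"

text \<open>The inner product of columns \<open>p\<close> and \<open>q\<close> is
  \<open>e ! p * e ! q / m\<close> times the geometric sum of \<open>z = f p * cnj (f q)\<close>.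
  This \<open>z\<close> is an \<open>m\<close>-th root of unity, and it equals 1 only for
  \<open>p = q\<close>.\<close>

lemma fourier_sign_matrix_unitary:
  assumes e: "e \<in> sign_lists m"
  shows "fourier_sign_matrix m e \<in> unitary_group m"
proof -
  have "(\<Sum>x<m. fourier_sign_matrix m e $$ (x, p) * cnj (fourier_sign_matrix m e $$ (x, q))) =
      (if p = q then 1 else 0)" if pq: "p < m" "q < m" for p q
  proof -
    have m: "m > 0" using pq by simp
    define f where "f = (\<lambda>k. cis (2 * pi * real k / real m))"
    define z where "z = f p * cnj (f q)"
    have bij: "bij_betw f {..<m} {z. z ^ m = 1}"
      unfolding f_def by (rule Complex.bij_betw_roots_unity[OF m])
    have unit: "f k * cnj (f k) = 1" for k
      by (simp add: f_def cis_cnj cis_mult)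
    have sq: "complex_of_real (sqrt (real m)) * complex_of_real (sqrt (real m)) = of_nat m"
      by (simp flip: of_real_mult)
    have "(\<Sum>x<m. fourier_sign_matrix m e $$ (x, p) * cnj (fourier_sign_matrix m e $$ (x, q))) =
        (\<Sum>x<m. of_real (e ! p * e ! q) / of_nat m * z ^ x)"
      using pq by (intro sum.cong refl)
        (simp add: fourier_sign_matrix_def z_def f_def power_mult_distrib sq[symmetric])
    also have "\<dots> = of_real (e ! p * e ! q) / of_nat m * (\<Sum>x<m. z ^ x)"
      by (simp add: sum_distrib_left)
    also have "\<dots> = (if p = q then 1 else 0)"
    proof (cases "p = q")
      case True
      then have "z = 1" using unit by (simp add: z_def)
      moreover have "e ! q * e ! q = 1" using nth_sign_lists[OF e pq(2)] by auto
      ultimately show ?thesis using True m by simp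
    next
      case False
      have "z \<noteq> 1"
      proof
        assume "z = 1"
        moreover have "z * f q = f p * (f q * cnj (f q))" by (simp only: z_def mult_ac)
        ultimately have "f p = f q" by (simp only: unit mult_1 mult_1_right)
        then show False using bij pq False by (auto simp: bij_betw_def inj_on_def)
      qed
      moreover have "z ^ m = 1"
      proof -
        have "f p ^ m = 1" "f q ^ m = 1" using bij pq by (auto simp: bij_betw_def)
        then have "cnj (f q) ^ m = 1" by (metis complex_cnj_one complex_cnj_power)
        then show ?thesis using \<open>f p ^ m = 1\<close> by (simp add: z_def power_mult_distrib)
      qed
      ultimately show ?thesis using False by (simp add: sum_gp_strict)
    qed
    finally show ?thesis .
  qed
  then show ?thesis
    by (auto simp: unitary_group_iff fourier_sign_matrix_def)
qed

lemma unitary_column_norm: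
  assumes "U \<in> unitary_group m" "k < m"
  shows "(\<Sum>i<m. (cmod (U $$ (i, k)))\<^sup>2) = 1"
proof -
  have "complex_of_real (\<Sum>i<m. (cmod (U $$ (i, k)))\<^sup>2) = 1"
    using unitary_column_sum[OF assms assms(2)] by (simp only: of_real_sum complex_norm_square if_True refl)
  then show ?thesis by (simp only: of_real_eq_1_iff)
qed

text \<open>The entry is a sum of signs with weights \<open>w i\<close> of squared modulus
  \<open>(cmod (U $$ (i, k)))\<^sup>2 / m\<close>. As column \<open>k\<close> is a unit vector,
  \<open>card_sign_cmod_gt\<close> applies with \<open>v = 1 / m\<close>, whatever \<open>U\<close>
  is.\<close>

lemma card_fourier_sign_entry_gt:
  assumes U: "U \<in> unitary_group m" and jk: "j < m" "k < m" and t: "t \<ge> 0"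
  shows "real (card {e \<in> sign_lists m. (cmod ((fourier_sign_matrix m e * U) $$ (j, k)))\<^sup>2 > t})
      \<le> 4 * 2 ^ m * exp (- (t * real m / 4))"
proof -
  have m: "m > 0" using jk by simp
  define w where "w i = cis (2 * pi * real i / real m) ^ j / of_real (sqrt (real m)) * U $$ (i, k)" for i
  have eq: "(fourier_sign_matrix m e * U) $$ (j, k) = (\<Sum>i<m. of_real (e ! i) * w i)" for e
    using unitary_group_carrier[OF U] jk
    by (simp add: scalar_prod_def atLeast0LessThan fourier_sign_matrix_def w_def mult.assoc)
  have "(cmod (w i))\<^sup>2 = (cmod (U $$ (i, k)))\<^sup>2 / real m" for i
    by (simp add: w_def norm_mult norm_divide norm_power power_mult_distrib power_divide)
  then have "(\<Sum>i<m. (cmod (w i))\<^sup>2) = 1 / real m"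
    by (simp add: sum_divide_distrib[symmetric] unitary_column_norm[OF U jk(2)])
  from card_sign_cmod_gt[OF eq_refl[OF this] _ t] m show ?thesis
    by (simp add: eq)
qed

text \<open>By left invariance \<open>B\<close> has the same measure as its preimage under every
  \<open>c e\<close>. Averaging over \<open>e\<close> and exchanging sum and integral leaves, for
  each fixed \<open>U\<close>, the number of sign lists that move \<open>U\<close> into
  \<open>B\<close>.\<close>

lemma haar_entry_tail:
  assumes haar: "haar_measure m \<mu>" and n: "n \<le> m" and t: "t \<ge> 0"
  shows "measure \<mu> {U \<in> space \<mu>. \<exists>j<m. \<exists>k<n. (cmod (U $$ (j, k)))\<^sup>2 > t}
      \<le> 4 * real m * real n * exp (- (t * real m / 4))"
proof -
  interpret prob_space \<mu> using haar by (simp add: haar_measure_def)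
  have sets: "sets \<mu> = sets (unitary_borel m)" using haar by (simp add: haar_measure_def)
  have space: "space \<mu> = unitary_group m" using sets_eq_imp_space_eq[OF sets] by simp
  define B where "B = {U \<in> space \<mu>. \<exists>j<m. \<exists>k<n. (cmod (U $$ (j, k)))\<^sup>2 > t}"
  have B: "B \<in> sets \<mu>"
    unfolding B_def sets space by (rule sets_unitary_entry_gt[OF n])
  define c where "c e = (\<lambda>U. fourier_sign_matrix m e * U)" for e
  have c: "c e \<in> measurable \<mu> \<mu>" if "e \<in> sign_lists m" for e
    using measurable_unitary_mult[OF fourier_sign_matrix_unitary[OF that]]
    by (simp add: c_def measurable_cong_sets[OF sets sets])
  have inv: "measure \<mu> B = measure \<mu> (c e -` B \<inter> space \<mu>)" if "e \<in> sign_lists m" for e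
  proof -
    have "distr \<mu> \<mu> (c e) = \<mu>"
      using haar fourier_sign_matrix_unitary[OF that] by (simp add: haar_measure_def c_def)
    then show ?thesis using measure_distr[OF c[OF that] B] by simp
  qed
  have "2 ^ m * measure \<mu> B = (\<Sum>e\<in>sign_lists m. measure \<mu> (c e -` B \<inter> space \<mu>))"
    by (simp add: inv[symmetric] card_sign_lists)
  also have "\<dots> = (\<Sum>e\<in>sign_lists m. \<integral>U. indicator (c e -` B \<inter> space \<mu>) U \<partial>\<mu>)"
    by (intro sum.cong refl) (simp add: Int_commute Int_left_commute)
  also have "\<dots> = (\<integral>U. (\<Sum>e\<in>sign_lists m. indicator (c e -` B \<inter> space \<mu>) U) \<partial>\<mu>)"
    by (rule Bochner_Integration.integral_sum[symmetric])
       (use measurable_sets[OF c B] in \<open>auto simp: emeasure_eq_measure\<close>)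
  also have "\<dots> \<le> (\<integral>U. real m * real n * (4 * 2 ^ m * exp (- (t * real m / 4))) \<partial>\<mu>)"
  proof (rule integral_mono)
    show "integrable \<mu> (\<lambda>U. \<Sum>e\<in>sign_lists m. indicator (c e -` B \<inter> space \<mu>) U :: real)"
      by (rule Bochner_Integration.integrable_sum)
         (use measurable_sets[OF c B] in \<open>auto simp: emeasure_eq_measure\<close>)
    fix U assume "U \<in> space \<mu>"
    then have U: "U \<in> unitary_group m" by (simp add: space)
    define E where "E j k = {e \<in> sign_lists m. (cmod (c e U $$ (j, k)))\<^sup>2 > t}" for j k
    have E: "real (card (E j k)) \<le> 4 * 2 ^ m * exp (- (t * real m / 4))" if "j < m" "k < n" for j k
      unfolding E_def c_def using card_fourier_sign_entry_gt[OF U that(1) _ t, of k] that n by simp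
    have "(\<Sum>e\<in>sign_lists m. indicator (c e -` B \<inter> space \<mu>) U) =
        real (card {e \<in> sign_lists m. c e U \<in> B})"
      using \<open>U \<in> space \<mu>\<close>
      by (simp add: indicator_def finite_sign_lists sum.If_cases Collect_conj_eq Int_commute)
    \<comment> \<open>Union bound over the \<open>m * n\<close> entries in the first
      \<open>n\<close> columns.\<close>
    also have "card {e \<in> sign_lists m. c e U \<in> B} \<le> card (\<Union>j\<in>{..<m}. \<Union>k\<in>{..<n}. E j k)"
      by (rule card_mono) (auto simp: finite_sign_lists B_def E_def)
    also have "\<dots> \<le> (\<Sum>j<m. \<Sum>k<n. card (E j k))"
      by (rule order.trans[OF card_UN_le] sum_mono card_UN_le finite_lessThan)+
    also have "real \<dots> \<le> (\<Sum>j<m. \<Sum>k<n. 4 * 2 ^ m * exp (- (t * real m / 4)))"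
      unfolding of_nat_sum by (intro sum_mono E) auto
    finally show "(\<Sum>e\<in>sign_lists m. indicator (c e -` B \<inter> space \<mu>) U)
        \<le> real m * real n * (4 * 2 ^ m * exp (- (t * real m / 4)))"
      by simp
  qed simp
  also have "\<dots> = 2 ^ m * (4 * real m * real n * exp (- (t * real m / 4)))"
    by (simp add: prob_space)
  finally show ?thesis by (simp add: B_def)
qed

section \<open>Small outcome probabilities and indistinguishability\<close>

text \<open>The permanent has \<open>fact n\<close> terms, each of modulus at most
  \<open>sqrt t ^ n\<close>, and the denominator is at least 1.\<close>

lemma boson_prob_le:
  assumes t: "t \<ge> 0" and entry: "\<And>j k. j < m \<Longrightarrow> k < n \<Longrightarrow> (cmod (U $$ (j, k)))\<^sup>2 \<le> t"
  shows "boson_prob m n U S \<le> (fact n)\<^sup>2 * t ^ n"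
proof (cases "S \<in> boson_samples m n")
  case True
  then have len: "length (row_indices S) = n" and m: "length S = m"
    by (auto simp: boson_samples_def length_row_indices)
  have row: "row_indices S ! i < m" if "i < n" for i
    using nth_mem[of i "row_indices S"] that len m by (auto simp: row_indices_def)
  let ?p = "permanent (boson_submatrix n U S)"
  have "cmod ?p \<le> (\<Sum>\<tau> | \<tau> permutes {..<n}. cmod (\<Prod>j<n. U $$ (row_indices S ! j, \<tau> j)))"
    unfolding boson_submatrix_def permanent_mat by (simp add: norm_sum)
  also have "\<dots> \<le> (\<Sum>\<tau> | \<tau> permutes {..<n}. sqrt t ^ n)"
  proof (rule sum_mono)
    fix \<tau> assume "\<tau> \<in> {\<tau>. \<tau> permutes {..<n}}"
    then have "\<tau> j < n" if "j < n" for j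
      using permutes_in_image[of \<tau> "{..<n}" j] that by simp
    then have "(\<Prod>j<n. cmod (U $$ (row_indices S ! j, \<tau> j))) \<le> (\<Prod>j<n. sqrt t)"
      by (intro prod_mono conjI norm_ge_zero real_le_rsqrt entry row) auto
    then show "cmod (\<Prod>j<n. U $$ (row_indices S ! j, \<tau> j)) \<le> sqrt t ^ n"
      by (simp add: prod_norm)
  qed
  also have "\<dots> = fact n * sqrt t ^ n"
    by (simp add: card_permutations)
  finally have "(cmod ?p)\<^sup>2 \<le> (fact n * sqrt t ^ n)\<^sup>2"
    by (rule power_mono) simp
  also have "\<dots> = (fact n)\<^sup>2 * t ^ n"
    using t by (simp add: power_mult_distrib power_commutes flip: power_mult)
       (simp add: power_mult mult.commute[of n])
  finally have p: "(cmod ?p)\<^sup>2 \<le> (fact n)\<^sup>2 * t ^ n" .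
  have "(1 :: real) \<le> (\<Prod>j<m. fact (S ! j))"
    by (rule prod_ge_1) simp
  then have "(cmod ?p)\<^sup>2 / (\<Prod>j<m. fact (S ! j)) \<le> (cmod ?p)\<^sup>2 / 1"
    by (intro divide_left_mono) auto
  then show ?thesis using True p by (simp add: boson_prob_def)
next
  case False
  then show ?thesis using t by (simp add: boson_prob_def)
qed

lemma measurable_boson_prob:
  assumes "n \<le> m"
  shows "(\<lambda>U. boson_prob m n U S) \<in> borel_measurable (unitary_borel m)"
proof (cases "S \<in> boson_samples m n")
  case True
  then have len: "length (row_indices S) = n" and m: "length S = m"
    by (auto simp: boson_samples_def length_row_indices)
  have row: "row_indices S ! i < m" if "i < n" for i
    using nth_mem[of i "row_indices S"] that len m by (auto simp: row_indices_def)
  have "(\<lambda>U. \<Sum>\<tau> | \<tau> permutes {..<n}. \<Prod>j<n. U $$ (row_indices S ! j, \<tau> j))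
      \<in> borel_measurable (unitary_borel m)"
  proof (intro borel_measurable_sum borel_measurable_prod measurable_unitary_entry)
    fix \<tau> j assume "\<tau> \<in> {\<tau>. \<tau> permutes {..<n}}" "j \<in> {..<n}"
    then show "row_indices S ! j < m" "\<tau> j < m"
      using permutes_in_image[of \<tau> "{..<n}" j] row assms by auto
  qed
  then show ?thesis
    using True by (simp add: boson_prob_def boson_submatrix_def permanent_mat)
qed (simp add: boson_prob_def)

lemma set_pmf_boson_sampling:
  assumes "U \<in> unitary_group m" "n \<le> m"
  shows "set_pmf (boson_sampling m n U) \<subseteq> boson_samples m n"
  by (auto simp: set_pmf_iff pmf_boson_sampling[OF assms] boson_prob_def split: if_splits)

text \<open>Off the event \<open>B\<close> of a large entry, all outcome probabilities are at most
  \<open>exp (- n)\<close>, and \<open>sample_lower_bound\<close> excludes the stated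
  \<open>l\<close>. The measure of \<open>B\<close> is controlled by
  \<open>haar_entry_tail\<close>.\<close>

lemma haar_indistinguishable:
  fixes n m :: nat and t :: real
  assumes haar: "haar_measure m \<mu>" and nm: "n \<le> m" "1 \<le> n" and t: "t \<ge> 0"
    and small: "(real n)\<^sup>2 * t \<le> exp (- 1)"
  shows "measure \<mu> {U \<in> space \<mu>.
           \<forall>l\<ge>1. real l \<le> 1 / 2 * exp (real n / 2) \<longrightarrow>
             \<not> (\<exists>A. symmetric_algorithm (boson_samples m n) l A \<and>
                    distinguishes l A (boson_sampling m n U) (pmf_of_set (boson_samples m n)))}
         \<ge> 1 - 4 * real m * real n * exp (- (t * real m / 4))"
    (is "measure \<mu> ?G \<ge> 1 - ?b")
proof -
  interpret prob_space \<mu> using haar by (simp add: haar_measure_def)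
  have sets: "sets \<mu> = sets (unitary_borel m)" using haar by (simp add: haar_measure_def)
  have space: "space \<mu> = unitary_group m" using sets_eq_imp_space_eq[OF sets] by simp
  let ?\<Phi> = "boson_samples m n"
  define B where "B = {U \<in> space \<mu>. \<exists>j<m. \<exists>k<n. (cmod (U $$ (j, k)))\<^sup>2 > t}"
  define D where "D l = {U \<in> space \<mu>. \<exists>A. symmetric_algorithm ?\<Phi> l A \<and>
      distinguishes l A (boson_sampling m n U) (pmf_of_set ?\<Phi>)}" for l
  have ne: "?\<Phi> \<noteq> {}" using nm by (intro boson_samples_nonempty) simp
  have "(\<lambda>U. pmf (boson_sampling m n U) S) \<in> borel_measurable \<mu>" for S
    using measurable_boson_prob[OF nm(1), of S] unfolding measurable_cong_sets[OF sets refl]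
    by (rule measurable_cong[THEN iffD1, rotated])
       (simp add: pmf_boson_sampling[OF _ nm(1)])
  then have D: "D l \<in> sets \<mu>" for l
    unfolding D_def using set_pmf_boson_sampling[OF _ nm(1)] ne
    by (intro sets_ex_distinguishing) (auto simp: finite_boson_samples space)
  \<comment> \<open>The complement of \<open>?G\<close> is a countable union of measurable sets.
    Since \<open>measure\<close> is 0 on nonmeasurable sets, a lower bound cannot do without
    this.\<close>
  have "?G = space \<mu> - (\<Union>l\<in>{l. 1 \<le> l \<and> real l \<le> 1 / 2 * exp (real n / 2)}. D l)"
    by (auto simp: D_def)
  then have G: "?G \<in> sets \<mu>"
    using D by (auto intro!: sets.countable_UN')
  \<comment> \<open>With \<open>fact n \<le> n ^ n\<close> the bound becomes an \<open>n\<close>-th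
    power, whose base is at most \<open>exp (- 1)\<close> by \<open>small\<close>.\<close>
  have "(fact n)\<^sup>2 * t ^ n \<le> (real n ^ n)\<^sup>2 * t ^ n"
    using t fact_le_power[of n, where 'a = real] by (intro mult_right_mono power_mono) auto
  also have "\<dots> = ((real n)\<^sup>2 * t) ^ n"
    by (simp add: power_mult_distrib flip: power_mult) (simp add: mult.commute)
  also have "\<dots> \<le> exp (- 1) ^ n"
    using small t by (intro power_mono) auto
  also have "\<dots> = exp (- real n)"
    by (simp flip: exp_of_nat_mult)
  finally have e: "(fact n)\<^sup>2 * t ^ n \<le> exp (- real n)" .
  have "space \<mu> - B \<subseteq> ?G"
  proof safe
    fix U l A assume U: "U \<in> space \<mu>" "U \<notin> B" and l: "real l \<le> 1 / 2 * exp (real n / 2)"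
      and A: "symmetric_algorithm ?\<Phi> l A"
      "distinguishes l A (boson_sampling m n U) (pmf_of_set ?\<Phi>)"
    have U': "U \<in> unitary_group m" using U space by simp
    have "boson_prob m n U S \<le> (fact n)\<^sup>2 * t ^ n" for S
    proof (rule boson_prob_le[OF t], rule ccontr)
      fix j k assume "j < m" "k < n" "\<not> (cmod (U $$ (j, k)))\<^sup>2 \<le> t"
      then have "U \<in> B" using U(1) unfolding B_def not_le by blast
      with U(2) show False by blast
    qed
    with e have "pmf (boson_sampling m n U) S \<le> exp (- real n)" for S
      using pmf_boson_sampling[OF U' nm(1)] order.trans by metis
    then have "1 / 3 \<le> (real l)\<^sup>2 * exp (- real n)"
      by (intro sample_lower_bound[OF finite_boson_samples A set_pmf_boson_sampling[OF U' nm(1)]])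
    also have "\<dots> \<le> (1 / 2 * exp (real n / 2))\<^sup>2 * exp (- real n)"
      using l by (intro mult_right_mono power_mono) auto
    \<comment> \<open>The factor 1/2 in the bound on \<open>l\<close> is chosen so that its square
      lies below 1/3.\<close>
    also have "\<dots> = 1 / 4"
      by (simp add: power_mult_distrib power2_eq_square mult_exp_exp)
    finally show False by simp
  qed
  then have "measure \<mu> (space \<mu> - B) \<le> measure \<mu> ?G"
    using G by (rule finite_measure_mono)
  moreover have "B \<in> sets \<mu>"
    unfolding B_def sets space by (rule sets_unitary_entry_gt[OF nm(1)])
  ultimately have "1 - measure \<mu> B \<le> measure \<mu> ?G"
    by (simp only: prob_compl)
  moreover have "measure \<mu> B \<le> ?b"
    unfolding B_def by (rule haar_entry_tail[OF haar nm(1) t])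
  ultimately show ?thesis by linarith
qed

theorem theorem2:
  fixes \<nu> :: real and m :: "nat \<Rightarrow> nat"
  assumes "\<nu> > 3"
    and "\<And>n. n \<ge> 1 \<Longrightarrow> m n \<ge> n"
    and "\<exists>k :: nat. (\<lambda>n. real (m n)) \<in> O(\<lambda>n. real n ^ k)"
    and "(\<lambda>n. real (m n)) \<in> \<Omega>(\<lambda>n. real n powr \<nu>)"
  shows "\<exists>(a :: real) (\<delta> :: nat \<Rightarrow> real).
    a > 0 \<and> range \<delta> \<subseteq> {0..1} \<and>
    (\<forall>C>0. (\<lambda>n. \<delta> n * exp (C * real n)) \<longlonglongrightarrow> 0) \<and>
    (\<forall>n\<ge>1. \<forall>\<mu>. haar_measure (m n) \<mu> \<longrightarrow>
       measure \<mu> {U \<in> space \<mu>.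
           \<forall>l\<ge>1. real l \<le> a * exp (real n / 2) \<longrightarrow>
             \<not> (\<exists>A. symmetric_algorithm (boson_samples (m n) n) l A \<and>
                    distinguishes l A (boson_sampling (m n) n U)
                      (pmf_of_set (boson_samples (m n) n)))}
         \<ge> 1 - \<delta> n)"
proof -
  \<comment> \<open>Here \<nu> = 3 + 2\<eta>. One \<eta> makes \<open>t n * m n\<close> equal to
    \<open>n powr (1 + \<eta>)\<close>, superlinear, so the tail beats every
    \<open>exp (- C * n)\<close>; the other leaves \<open>n\<^sup>2 * t n\<close> of order at most
    \<open>n powr (- \<eta>)\<close>.\<close>
  define \<eta> where "\<eta> = (\<nu> - 3) / 2"
  have \<eta>: "\<eta> > 0" using assms(1) by (simp add: \<eta>_def)
  define t where "t n = real n powr (1 + \<eta>) / real (m n)" for n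
  define b where "b n = 4 * real (m n) * real n * exp (- (real n powr (1 + \<eta>) / 4))" for n
  \<comment> \<open>The entry threshold is small enough only eventually. For the remaining
    \<open>n\<close> the value 1 makes the claim trivial, and \<open>min\<close> keeps the range
    within [0, 1].\<close>
  define \<delta> where "\<delta> n = (if (real n)\<^sup>2 * t n \<le> exp (- 1) then min 1 (b n) else 1)" for n
  obtain c where c: "c > 0"
    "\<forall>\<^sub>F n in sequentially. real (m n) \<ge> c * real n powr \<nu>"
    using landau_omega.bigE[OF assms(4)] by auto
  have small: "\<forall>\<^sub>F n in sequentially. (real n)\<^sup>2 * t n \<le> exp (- 1)"
  proof -
    have "(\<lambda>n. real n powr (- \<eta>) / c) \<longlonglongrightarrow> 0"
      using \<eta> c(1) by real_asymp
    then have "\<forall>\<^sub>F n in sequentially. real n powr (- \<eta>) / c < exp (- 1)"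
      by (rule order_tendstoD) simp
    with c(2) eventually_ge_at_top[of 1] show ?thesis
    proof eventually_elim
      case (elim n)
      then have n: "real n > 0" by simp
      then have "m n > 0" using assms(2)[of n] by simp
      have "(real n)\<^sup>2 * t n = real n powr (3 + \<eta>) / real (m n)"
        using n by (simp add: t_def powr_add power2_eq_square power3_eq_cube powr_numeral)
      also have "\<dots> \<le> real n powr (3 + \<eta>) / (c * real n powr \<nu>)"
        using elim c(1) n by (intro divide_left_mono) (auto intro!: mult_pos_pos simp: \<open>m n > 0\<close>)
      also have "\<dots> = real n powr (- \<eta>) / c"
      proof -
        have "\<nu> = (3 + \<eta>) + \<eta>" by (simp add: \<eta>_def field_simps)
        then have "real n powr \<nu> = real n powr (3 + \<eta>) * real n powr \<eta>" by (metis powr_add)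
        then show ?thesis using n by (simp add: powr_minus field_simps)
      qed
      finally show ?case using elim by simp
    qed
  qed
  obtain k :: nat where "(\<lambda>n. real (m n)) \<in> O(\<lambda>n. real n ^ k)" using assms(3) by blast
  then obtain K where K: "K > 0" "\<forall>\<^sub>F n in sequentially. real (m n) \<le> K * real n ^ k"
    by (elim landau_o.bigE) (auto simp: norm_power)
  have lim: "(\<lambda>n. \<delta> n * exp (C * real n)) \<longlonglongrightarrow> 0" if C: "C > 0" for C
  proof (rule Lim_null_comparison)
    show "\<forall>\<^sub>F n in sequentially. norm (\<delta> n * exp (C * real n)) \<le>
        4 * K * (real n powr (real k + 1) * exp (- (real n powr (1 + \<eta>) / 4)) * exp (C * real n))"
      using K(2) small eventually_ge_at_top[of 1]
    proof eventually_elim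
      case (elim n)
      have "b n \<ge> 0" by (simp add: b_def)
      then have "norm (\<delta> n * exp (C * real n)) \<le> b n * exp (C * real n)"
        using elim by (simp add: \<delta>_def)
      also have "\<dots> \<le> 4 * (K * real n ^ k) * real n * exp (- (real n powr (1 + \<eta>) / 4)) * exp (C * real n)"
        unfolding b_def using elim by (intro mult_right_mono mult_left_mono) auto
      finally show ?case using elim by (simp add: powr_add powr_realpow mult_ac)
    qed
    \<comment> \<open>The exponent of order \<open>n powr (1 + \<eta>)\<close> dominates both
      \<open>C * n\<close> and the polynomial factor from the growth of \<open>m\<close>.\<close>
    have "(\<lambda>n. real n powr (real k + 1) * exp (- (real n powr (1 + \<eta>) / 4)) * exp (C * real n)) \<longlonglongrightarrow> 0"
      using \<eta> C by real_asymp
    then show "(\<lambda>n. 4 * K * (real n powr (real k + 1) * exp (- (real n powr (1 + \<eta>) / 4)) * exp (C * real n)))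
        \<longlonglongrightarrow> 0"
      by (rule tendsto_mult_right_zero)
  qed
  show ?thesis
  proof (intro exI[of _ "1 / 2"] exI[of _ \<delta>] conjI allI impI lim)
    show "range \<delta> \<subseteq> {0..1}"
      by (auto simp: \<delta>_def b_def)
    fix n \<mu> assume n: "n \<ge> 1" and haar: "haar_measure (m n) \<mu>"
    let ?G = "{U \<in> space \<mu>.
           \<forall>l\<ge>1. real l \<le> 1 / 2 * exp (real n / 2) \<longrightarrow>
             \<not> (\<exists>A. symmetric_algorithm (boson_samples (m n) n) l A \<and>
                    distinguishes l A (boson_sampling (m n) n U)
                      (pmf_of_set (boson_samples (m n) n)))}"
    show "1 - \<delta> n \<le> measure \<mu> ?G"
    proof (cases "(real n)\<^sup>2 * t n \<le> exp (- 1)")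
      case True
      have "m n > 0" using assms(2)[OF n] n by simp
      then have "b n = 4 * real (m n) * real n * exp (- (t n * real (m n) / 4))"
        by (simp add: b_def t_def)
      moreover have "t n \<ge> 0" by (simp add: t_def)
      ultimately have "1 - b n \<le> measure \<mu> ?G"
        using haar_indistinguishable[OF haar assms(2)[OF n] n _ True] by simp
      then show ?thesis using True measure_nonneg[of \<mu> ?G] by (simp add: \<delta>_def min_def)
    qed (simp add: \<delta>_def)
  qed simp
qed

end
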